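(* Let $B \sim \mathbb{B}(n,p)$, where $p=p(n)$ satisfies $p = \omega(1/n)$ and $p \le 1/2$. Then with probability $1-o(1)$ as $n\to\infty$, one of the following holds: (1) For all $k$, all minimal dependencies of $k$ columns of $B$ are in $\mathcal{T}_k$ (that is, for every $S\subseteq[n]$ with $|S|=k$, if $B_S$ is a minimal linear dependency then $B_S\in\mathcal{T}_k$). (2) For all $k$, all minimal dependencies of $k$ columns of $B^\top$ are in $\mathcal{T}_k$ (that is, for every $S\subseteq[n]$ with $|S|=k$, if $(B^\top)_S$ is a minimal linear dependency then $(B^\top)_S\in\mathcal{T}_k$).
   Context: $\mathbb{B}(n,p)$ is the distribution of the random matrix in $\{0,1\}^{n\times n}$ all of whose entries are independent Bernoulli($p$). $M_S$ denotes the submatrix of $M$ consisting of the columns indexed by $S$. A matrix $M \in \mathbb{R}^{m\times k}$ is a minimal linear dependency (minimal dependency) if (1) there exists $x\in\mathbb{R}^k$ with $Mx = 0$ and $\operatorname{supp}(x) = [k]$, and (2) $\operatorname{rank}(M) = k-1$. $\mathcal{T}_k$ (tree dependencies) is the set of matrices $M \in \bigcup_m \{0,1\}^{m\times k}$ with exactly $2k-2$ ones such that the non-zero rows of $M$ form the edge-vertex incidence matrix (rows indexed by edges, columns indexed by vertices) of a tree on $k$ vertices. *)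

theory Defs
  imports "HOL-Probability.Probability" "Jordan_Normal_Form.DL_Rank" "Jordan_Normal_Form.DL_Submatrix"
begin

unbundle no vec_syntax
hide_const (open) Finite_Cartesian_Product.vec Finite_Cartesian_Product.mat

definition bernoulli_mat :: "nat \<Rightarrow> real \<Rightarrow> real mat pmf" where
  "bernoulli_mat n p =
     map_pmf (\<lambda>X. Matrix.mat n n (\<lambda>ij. of_bool (X ij)))
       (Pi_pmf ({..<n} \<times> {..<n}) False (\<lambda>_. bernoulli_pmf p))"

abbreviation columns_submat :: "real mat \<Rightarrow> nat set \<Rightarrow> real mat" where
  "columns_submat M S \<equiv> submatrix M UNIV S"

text \<open>
  The rank condition is phrased without truncated subtraction, so that a matrix without
  columns is not a minimal dependency.
\<close>
definition minimal_dependency :: "real mat \<Rightarrow> bool" where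
  "minimal_dependency M \<longleftrightarrow>
     (\<exists>x \<in> carrier_vec (dim_col M).
        M *\<^sub>v x = 0\<^sub>v (dim_row M) \<and> {j. j < dim_col M \<and> x $ j \<noteq> 0} = {..<dim_col M}) \<and>
     vec_space.rank (dim_row M) M + 1 = dim_col M"

text \<open>
  Finite simple graphs are given by a vertex set and a set of two-element subsets of it.
  The notion of tree in the AFP entry Graph Theory is not used here, because it only excludes
  directed cycles.
\<close>
definition simple_graph :: "'v set \<Rightarrow> 'v set set \<Rightarrow> bool" where
  "simple_graph V E \<longleftrightarrow> finite V \<and> (\<forall>e \<in> E. e \<subseteq> V \<and> card e = 2)"

definition graph_connected :: "'v set \<Rightarrow> 'v set set \<Rightarrow> bool" where
  "graph_connected V E \<longleftrightarrow> V \<noteq> {} \<and> (\<forall>u \<in> V. \<forall>v \<in> V. (u, v) \<in> {(a, b). {a, b} \<in> E}\<^sup>*)"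

definition graph_cycle :: "'v set set \<Rightarrow> 'v list \<Rightarrow> bool" where
  "graph_cycle E vs \<longleftrightarrow> length vs \<ge> 3 \<and> distinct vs \<and>
     (\<forall>i < length vs. {vs ! i, vs ! (Suc i mod length vs)} \<in> E)"

definition is_tree :: "'v set \<Rightarrow> 'v set set \<Rightarrow> bool" where
  "is_tree V E \<longleftrightarrow> simple_graph V E \<and> graph_connected V E \<and> (\<nexists>vs. graph_cycle E vs)"

text \<open>
  The vertices of the tree are the column indices; the bijection \<open>f\<close> says that each edge is
  the incidence vector of exactly one non-zero row. The number of ones is again
  phrased without truncated subtraction.
\<close>
definition tree_dependencies :: "nat \<Rightarrow> real mat set" where
  "tree_dependencies k =
     {M. dim_col M = k \<and>
         (\<forall>i < dim_row M. \<forall>j < k. M $$ (i, j) \<in> {0, 1}) \<and>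
         card {(i, j). i < dim_row M \<and> j < k \<and> M $$ (i, j) = 1} + 2 = 2 * k \<and>
         (\<exists>E f. is_tree {..<k} E \<and>
            bij_betw f {i. i < dim_row M \<and> row M i \<noteq> 0\<^sub>v k} E \<and>
            (\<forall>i < dim_row M. row M i \<noteq> 0\<^sub>v k \<longrightarrow>
               (\<forall>j < k. M $$ (i, j) = of_bool (j \<in> f i))))}"

definition only_tree_dependencies :: "real mat \<Rightarrow> bool" where
  "only_tree_dependencies M \<longleftrightarrow>
     (\<forall>k. \<forall>S \<subseteq> {..<dim_col M}. card S = k \<longrightarrow>
        minimal_dependency (columns_submat M S) \<longrightarrow> columns_submat M S \<in> tree_dependencies k)"

end

theory Submission
  imports Defs "HOL-Real_Asymp.Real_Asymp"
begin

text \<open>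
  If the columns in \<open>S\<close> form a minimal dependency, then the kernel of these columns is a line,
  spanned by a vector \<open>x\<close> without zeros. Hence no row has exactly one \<open>1\<close> in \<open>S\<close>. With \<open>k = |S|\<close>, at
  least \<open>k - 1\<close> rows are non-zero on \<open>S\<close>, and if there are exactly \<open>k - 1\<close> of them with two ones each,
  then they are the edges of a tree (\<open>circuit_graphic_is_tree\<close>). Let \<open>d = n p\<close>, which tends to
  infinity. Dependencies that are not trees are excluded according to their size.

  Few columns, \<open>k p \<le> K\<close> for a constant \<open>K\<close>: outside of the tree case there are \<open>k\<close> rows with at
  least two ones, or \<open>k - 1\<close> rows with at least two ones of which one even has three. At the same time all other rows
  avoid having a single one, which costs a factor \<open>exp (- c k d)\<close> with \<open>c > 0\<close> depending on \<open>K\<close> only.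
  A union bound over columns and rows leaves a geometric series whose ratio is of the order of
  \<open>d\<^sup>2 exp (- c d)\<close> (\<open>prob_non_graphic_circuit_small\<close>).

  A moderate number of columns, \<open>k p \<ge> K\<close> and \<open>k \<le> n / 2\<close>: some \<open>k - 1\<close> rows determine \<open>x\<close> up to a
  factor (\<open>circuit_determining_rows\<close>), and the remaining rows are independent of \<open>x\<close>. By the
  Littlewood-Offord inequality each of them is orthogonal to \<open>x\<close> with probability at most
  \<open>1 / sqrt (2 p (k + 1))\<close> (\<open>bernoulli_littlewood_offord\<close>). If \<open>K\<close> is large, then the product over at
  least \<open>n / 2\<close> rows beats the number of choices for columns and rows, which is at most \<open>4\<^sup>n\<close>
  (\<open>prob_circuit_medium\<close>).

  More than \<open>n / 2\<close> columns: \<open>B\<close> may have such dependencies with a substantial probability, but \<open>B\<close> and its transpose rarely have them simultaneously. A kernel vector of the transpose with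
  large support says that more than half of the rows of \<open>B\<close> depend on the other rows. Such a row is
  orthogonal to a kernel vector of \<open>B\<close>, which can be chosen from the other rows alone and has large
  support, so that the Littlewood-Offord inequality makes this unlikely
  (\<open>prob_two_large_kernels\<close>).

  The first two cases concern \<open>B\<close> and its transpose separately, and the two matrices have the same
  distribution.
\<close>

section \<open>Linear systems whose solutions form a line\<close>

definition in_kernel :: "('i \<Rightarrow> 'j \<Rightarrow> real) \<Rightarrow> 'i set \<Rightarrow> 'j set \<Rightarrow> ('j \<Rightarrow> real) \<Rightarrow> bool" where
  "in_kernel a I S y \<longleftrightarrow> (\<forall>i\<in>I. (\<Sum>j\<in>S. a i j * y j) = 0)"

text \<open>
  The kernel of the columns in \<open>S\<close> is the line spanned by a vector without zeros, so the columns
  form a circuit of the column matroid. The row set is a parameter because the same notion is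
  needed for a few rows that already determine the line.
\<close>
definition is_circuit :: "('i \<Rightarrow> 'j \<Rightarrow> real) \<Rightarrow> 'i set \<Rightarrow> 'j set \<Rightarrow> ('j \<Rightarrow> real) \<Rightarrow> bool" where
  "is_circuit a I S x \<longleftrightarrow> in_kernel a I S x \<and> (\<forall>j\<in>S. x j \<noteq> 0) \<and>
     (\<forall>y. in_kernel a I S y \<longrightarrow> (\<exists>c. \<forall>j\<in>S. y j = c * x j))"

text \<open>
  Gaussian elimination of one unknown against one equation. All dimension counts below reduce to
  this statement.
\<close>
lemma underdetermined_system:
  assumes "finite I" "finite S" "card I < card S"
  shows "\<exists>y. in_kernel a I S y \<and> (\<exists>j\<in>S. y j \<noteq> 0)"
  using assms
proof (induction I arbitrary: S a rule: finite_induct)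
  case empty
  then show ?case by (intro exI[of _ "\<lambda>_. 1"]) (auto simp: in_kernel_def card_gt_0_iff)
next
  case (insert i I)
  show ?case
  proof (cases "\<forall>j\<in>S. a i j = 0")
    case True
    from insert obtain y where "in_kernel a I S y" "\<exists>j\<in>S. y j \<noteq> 0" 
      by (metis card_insert_disjoint Suc_lessD)
    with True show ?thesis by (auto simp: in_kernel_def)
  next
    case False
    then obtain k where k: "k \<in> S" "a i k \<noteq> 0" by auto
    define S' where "S' = S - {k}"
    define b where "b = (\<lambda>i' j. a i' j - a i' k * a i j / a i k)"
    have "card I < card S'" "finite S'"
      using insert k by (auto simp: S'_def)
    then obtain y where y: "in_kernel b I S' y" "\<exists>j\<in>S'. y j \<noteq> 0"
      using insert.IH by blast
    define z where "z = y(k := - (\<Sum>j\<in>S'. a i j * y j) / a i k)"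
    have z: "(\<Sum>j\<in>S. a i' j * z j) = (\<Sum>j\<in>S'. a i' j * y j) - a i' k * (\<Sum>j\<in>S'. a i j * y j) / a i k" for i'
    proof -
      have "(\<Sum>j\<in>S. a i' j * z j) = a i' k * z k + (\<Sum>j\<in>S'. a i' j * z j)"
        using k insert.prems by (simp add: S'_def sum.remove)
      also have "(\<Sum>j\<in>S'. a i' j * z j) = (\<Sum>j\<in>S'. a i' j * y j)"
        by (intro sum.cong) (auto simp: z_def S'_def)
      finally show ?thesis by (simp add: z_def)
    qed
    have "(\<Sum>j\<in>S'. a i' j * y j) - a i' k * (\<Sum>j\<in>S'. a i j * y j) / a i k = (\<Sum>j\<in>S'. b i' j * y j)" for i'
      by (simp add: b_def sum_distrib_left sum_divide_distrib left_diff_distrib sum_subtractf mult.assoc)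
    with z y(1) have "in_kernel a I S z" by (simp add: in_kernel_def)
    moreover have "(\<Sum>j\<in>S. a i j * z j) = 0" using z[of i] k by simp
    moreover have "\<exists>j\<in>S. z j \<noteq> 0" using y(2) by (auto simp: z_def S'_def)
    ultimately show ?thesis by (auto simp: in_kernel_def)
  qed
qed

text \<open>
  The extra equation \<open>y s = 0\<close> leaves only the zero vector on the line, so it and the rows in
  \<open>R\<close> together form a system without non-trivial solutions.
\<close>
lemma card_determining_rows_ge:
  assumes "is_circuit a I S x" "finite R" "finite S"
    and "\<And>y. in_kernel a R S y \<Longrightarrow> in_kernel a I S y"
  shows "card S \<le> card R + 1"
proof (rule ccontr)
  assume "\<not> ?thesis"
  then have lt: "card R + 1 < card S" by simp
  then obtain s where s: "s \<in> S" by fastforce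
  obtain y where y: "in_kernel a R (S - {s}) y" "\<exists>j\<in>S-{s}. y j \<noteq> 0"
    using underdetermined_system[of R "S - {s}" a] assms(2,3) lt s by (fastforce simp: card_Diff_singleton)
  have "(\<Sum>j\<in>S. a i j * (y(s := 0)) j) = (\<Sum>j\<in>S-{s}. a i j * y j)" for i
    using s assms(3) by (simp add: sum.remove)
  with y(1) have "in_kernel a R S (y(s := 0))" by (simp add: in_kernel_def)
  then obtain c where c: "\<forall>j\<in>S. (y(s := 0)) j = c * x j"
    using assms(1,4) unfolding is_circuit_def by blast
  with s assms(1) have "c = 0" unfolding is_circuit_def by (metis fun_upd_same mult_eq_0_iff)
  with c y(2) show False by (metis DiffE fun_upd_other insertI1 mult_zero_left)
qed

lemma is_circuit_superset:
  assumes "is_circuit a R S x" "R \<subseteq> R'" "in_kernel a R' S x"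
  shows "is_circuit a R' S x"
  using assms unfolding is_circuit_def in_kernel_def by blast

text \<open>
  In a smallest row set that still determines the line, every row \<open>i\<close> is violated by some solution
  \<open>w i\<close> of the other rows. These solutions and \<open>x\<close> are linearly independent vectors on \<open>S\<close>, since
  applying row \<open>i\<close> to a relation between them isolates the coefficient of \<open>w i\<close>.
\<close>
lemma circuit_determining_rows:
  assumes circ: "is_circuit a I S x" and fin: "finite I" "finite S" and "S \<noteq> {}"
  shows "\<exists>R\<subseteq>I. card R + 1 \<le> card S \<and> is_circuit a R S x"
proof -
  obtain R where R: "R \<subseteq> I" "is_circuit a R S x"
    and min: "\<And>R'. R' \<subseteq> I \<Longrightarrow> is_circuit a R' S x \<Longrightarrow> card R \<le> card R'"
    using ex_has_least_nat[of "\<lambda>R. R \<subseteq> I \<and> is_circuit a R S x" I card] circ by blast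
  have finR: "finite R" using R fin finite_subset by blast
  have "\<exists>y. in_kernel a (R - {i}) S y \<and> (\<Sum>j\<in>S. a i j * y j) \<noteq> 0" if "i \<in> R" for i
  proof -
    have "\<not> is_circuit a (R - {i}) S x"
      using min[of "R - {i}"] R that finR by (meson Diff_subset card_Diff1_less not_less subset_trans)
    moreover have "in_kernel a (R - {i}) S x" "\<forall>j\<in>S. x j \<noteq> 0"
      using R(2) by (auto simp: is_circuit_def in_kernel_def)
    ultimately obtain y where y: "in_kernel a (R - {i}) S y" "\<nexists>c. \<forall>j\<in>S. y j = c * x j"
      unfolding is_circuit_def by blast
    then have "\<not> in_kernel a R S y" using R(2) unfolding is_circuit_def by blast
    with y(1) show ?thesis unfolding in_kernel_def by blast
  qed
  then obtain w where w: "\<And>i. i \<in> R \<Longrightarrow> in_kernel a (R - {i}) S (w i)"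
    "\<And>i. i \<in> R \<Longrightarrow> (\<Sum>j\<in>S. a i j * w i j) \<noteq> 0"
    by metis
  have "card R + 1 \<le> card S"
  proof (rule ccontr)
    assume "\<not> ?thesis"
    \<comment> \<open>the unknowns are the coefficients of a relation: \<open>Some i\<close> for \<open>w i\<close>, and \<open>None\<close> for \<open>x\<close>\<close>
    then have "card S < card (insert None (Some ` R))"
      using finR by (simp add: card_insert_if card_image)
    then obtain c where c: "in_kernel (\<lambda>s u. case u of None \<Rightarrow> x s | Some i \<Rightarrow> w i s) S (insert None (Some ` R)) c"
      "\<exists>u\<in>insert None (Some ` R). c u \<noteq> 0"
      using underdetermined_system[of S "insert None (Some ` R)"] fin finR by blast
    have comb: "x s * c None + (\<Sum>i\<in>R. w i s * c (Some i)) = 0" if "s \<in> S" for s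
      using c(1) that finR by (simp add: in_kernel_def sum.reindex)
    have "c (Some i) = 0" if i: "i \<in> R" for i
    proof -
      have "0 = (\<Sum>s\<in>S. a i s * (x s * c None + (\<Sum>i'\<in>R. w i' s * c (Some i'))))"
        using comb by simp
      also have "\<dots> = c None * (\<Sum>s\<in>S. a i s * x s) + (\<Sum>s\<in>S. \<Sum>i'\<in>R. a i s * w i' s * c (Some i'))"
        by (simp add: distrib_left sum.distrib sum_distrib_left mult_ac)
      also have "(\<Sum>s\<in>S. a i s * x s) = 0"
        using R(2) i by (simp add: is_circuit_def in_kernel_def)
      also have "(\<Sum>s\<in>S. \<Sum>i'\<in>R. a i s * w i' s * c (Some i')) = (\<Sum>i'\<in>R. c (Some i') * (\<Sum>s\<in>S. a i s * w i' s))"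
        by (subst sum.swap) (simp add: sum_distrib_left mult_ac)
      also have "\<dots> = (\<Sum>i'\<in>R. if i' = i then c (Some i) * (\<Sum>s\<in>S. a i s * w i s) else 0)"
        using w(1) i by (intro sum.cong) (auto simp: in_kernel_def)
      also have "\<dots> = c (Some i) * (\<Sum>s\<in>S. a i s * w i s)"
        using finR i by simp
      finally show ?thesis using w(2)[OF i] by simp
    qed
    moreover from this \<open>S \<noteq> {}\<close> have "c None = 0"
      using comb R(2) unfolding is_circuit_def by fastforce
    ultimately show False using c(2) by auto
  qed
  with R show ?thesis by blast
qed

lemma is_circuit_reindex:
  assumes f: "bij_betw f T S" and circ: "is_circuit (\<lambda>i j. a i (f j)) I T x"
  shows "is_circuit a I S (x \<circ> inv_into T f)"
proof -
  have inv: "inv_into T f (f j) = j" if "j \<in> T" for j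
    using f that by (simp add: bij_betw_inv_into_left)
  have sum: "(\<Sum>j\<in>S. a i j * y j) = (\<Sum>j\<in>T. a i (f j) * y (f j))" for i y
    using sum.reindex_bij_betw[OF f, of "\<lambda>j. a i j * y j"] by simp
  have ker: "in_kernel a I S y \<longleftrightarrow> in_kernel (\<lambda>i j. a i (f j)) I T (y \<circ> f)" for y
    by (simp add: in_kernel_def sum)
  have ball: "(\<forall>j\<in>S. P j) \<longleftrightarrow> (\<forall>j\<in>T. P (f j))" for P
    using f by (auto simp: bij_betw_def)
  have "in_kernel a I S (x \<circ> inv_into T f)"
    using circ inv unfolding ker by (simp add: is_circuit_def in_kernel_def)
  then show ?thesis
    using circ unfolding is_circuit_def ball by (simp add: inv) (metis ker comp_apply)
qed

section \<open>Trees from circuits of zero-one vectors\<close>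

definition ones :: "('i \<Rightarrow> 'j \<Rightarrow> bool) \<Rightarrow> 'j set \<Rightarrow> 'i \<Rightarrow> 'j set" where
  "ones X S i = {j \<in> S. X i j}"

abbreviation bmat :: "('i \<Rightarrow> 'j \<Rightarrow> bool) \<Rightarrow> 'i \<Rightarrow> 'j \<Rightarrow> real" where
  "bmat X \<equiv> \<lambda>i j. of_bool (X i j)"

lemma in_kernel_bmat:
  assumes "finite S"
  shows "in_kernel (bmat X) I S y \<longleftrightarrow> (\<forall>i\<in>I. sum y (ones X S i) = 0)"
  using assms by (simp add: in_kernel_def ones_def of_bool_def if_distrib[of "\<lambda>u. u * _"] sum.If_cases Int_def cong: if_cong)

lemma circuit_card_ones_ne_1:
  assumes "is_circuit (bmat X) I S x" "finite S" "i \<in> I"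
  shows "card (ones X S i) \<noteq> 1"
proof
  assume "card (ones X S i) = 1"
  then obtain j where j: "ones X S i = {j}" by (auto simp: card_1_singleton_iff)
  then have "x j \<noteq> 0" using assms(1) by (auto simp: is_circuit_def ones_def)
  moreover have "sum x (ones X S i) = 0"
    using assms(1,3) unfolding is_circuit_def in_kernel_bmat[OF assms(2)] by blast
  ultimately show False using j by simp
qed

text \<open>
  The extremal case of a circuit of \<open>0\<close>-\<open>1\<close> vectors: as few non-zero rows as the rank permits, and as
  few ones in each of them as a vector without zeros in the kernel permits.
\<close>
definition graphic :: "('i \<Rightarrow> 'j \<Rightarrow> bool) \<Rightarrow> 'i set \<Rightarrow> 'j set \<Rightarrow> bool" where
  "graphic X I S \<longleftrightarrow> card {i \<in> I. ones X S i \<noteq> {}} + 1 = card S \<and>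
     (\<forall>i\<in>I. ones X S i \<noteq> {} \<longrightarrow> card (ones X S i) = 2)"

text \<open>
  One row fewer would leave a kernel of dimension at least two, so each of the rows is essential.
  This excludes repeated rows. A connected component \<open>C\<close> yields the kernel vector that agrees with
  \<open>x\<close> on \<open>C\<close> and vanishes elsewhere; it is a multiple of \<open>x\<close>, hence \<open>C\<close> is everything. Along an edge,
  the ratio of any kernel vector to \<open>x\<close> is constant. If an edge closes a cycle, then this ratio
  already agrees at its two ends because of the other edges, so its row is not essential.
\<close>
lemma circuit_graphic_is_tree:
  assumes circ: "is_circuit (bmat X) I S x" and fin: "finite I" "finite S" and gr: "graphic X I S"
  defines "N \<equiv> {i \<in> I. ones X S i \<noteq> {}}"
  shows "inj_on (ones X S) N" "is_tree S (ones X S ` N)"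
proof -
  note ker = in_kernel_bmat[OF fin(2)]
  have finN: "finite N" using fin by (simp add: N_def)
  have cardN: "card N + 1 = card S" using gr by (simp add: graphic_def N_def)
  have two: "card (ones X S i) = 2" if "i \<in> N" for i
    using gr that by (auto simp: graphic_def N_def)
  have kerN: "in_kernel (bmat X) I S y" if "in_kernel (bmat X) N S y" for y
    using that unfolding ker N_def by force
  have essential: "\<exists>y. in_kernel (bmat X) (N - {i}) S y \<and> sum y (ones X S i) \<noteq> 0" if i: "i \<in> N" for i
  proof (rule ccontr)
    assume "\<not> ?thesis"
    then have "in_kernel (bmat X) N S y" if "in_kernel (bmat X) (N - {i}) S y" for y
      using that unfolding ker by blast
    then have "card S \<le> card (N - {i}) + 1"
      using card_determining_rows_ge[OF circ _ fin(2), of "N - {i}"] kerN finN by blast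
    then show False using cardN i finN by (simp add: card_Diff_singleton_if card_gt_0_iff split: if_splits) (metis Suc_pred card_gt_0_iff empty_iff not_less_eq_eq order_refl)
  qed
  have xker: "sum x (ones X S i) = 0" if "i \<in> N" for i
    using circ that by (simp add: is_circuit_def ker N_def)
  have xnz: "x j \<noteq> 0" if "j \<in> S" for j using circ that by (simp add: is_circuit_def)
  show inj: "inj_on (ones X S) N"
  proof (rule inj_onI, rule ccontr)
    fix i i' assume i: "i \<in> N" "i' \<in> N" "ones X S i = ones X S i'" "i \<noteq> i'"
    obtain y where "in_kernel (bmat X) (N - {i}) S y" "sum y (ones X S i) \<noteq> 0"
      using essential[OF i(1)] by blast
    with i show False unfolding ker by auto
  qed
  define E where "E = ones X S ` N"
  have edge: "u \<noteq> v \<and> u \<in> S \<and> v \<in> S" if "{u, v} \<in> E" for u v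
  proof -
    from that obtain i where "i \<in> N" "ones X S i = {u, v}" by (auto simp: E_def)
    with two[of i] show ?thesis by (cases "u = v") (auto simp: ones_def)
  qed
  have simple: "simple_graph S E"
    using fin(2) two by (auto simp: simple_graph_def E_def ones_def)
  have Sne: "S \<noteq> {}" using cardN by auto
  have connected: "graph_connected S E"
    unfolding graph_connected_def
  proof (intro conjI ballI)
    fix u v assume uv: "u \<in> S" "v \<in> S"
    define C where "C = {v. (u, v) \<in> {(a, b). {a, b} \<in> E}\<^sup>*}"
    define y where "y = (\<lambda>j. if j \<in> C then x j else 0)"
    have "sum y (ones X S i) = 0" if i: "i \<in> N" for i
    proof -
      obtain a b where ab: "ones X S i = {a, b}" "a \<noteq> b"
        using two[OF i] by (auto simp: card_2_iff)
      have E: "{a, b} \<in> E" "{b, a} \<in> E" using i ab by (auto simp: E_def insert_commute intro!: rev_image_eqI)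
      have "a \<in> C \<longleftrightarrow> b \<in> C"
        unfolding C_def using E by (auto intro: rtrancl.rtrancl_into_rtrancl)
      then show ?thesis using xker[OF i] ab by (auto simp: y_def)
    qed
    then have "in_kernel (bmat X) I S y" by (intro kerN) (simp add: ker)
    then obtain c where c: "\<forall>j\<in>S. y j = c * x j" using circ unfolding is_circuit_def by blast
    have "u \<in> C" by (simp add: C_def)
    then have "c = 1" using c uv(1) xnz[OF uv(1)] by (auto simp: y_def)
    then have "y v \<noteq> 0" using c uv(2) xnz[OF uv(2)] by simp
    then show "(u, v) \<in> {(a, b). {a, b} \<in> E}\<^sup>*" by (auto simp: y_def C_def split: if_splits)
  qed (rule Sne)
  have "\<nexists>vs. graph_cycle E vs"
  proof
    assume "\<exists>vs. graph_cycle E vs"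
    then obtain vs where vs: "length vs \<ge> 3" "distinct vs"
      "\<And>i. i < length vs \<Longrightarrow> {vs ! i, vs ! (Suc i mod length vs)} \<in> E"
      by (auto simp: graph_cycle_def)
    define L where "L = length vs - 1"
    have L: "length vs = Suc L" "L \<ge> 2" using vs(1) by (auto simp: L_def)
    obtain i0 where i0: "i0 \<in> N" "ones X S i0 = {vs ! L, vs ! 0}"
      using vs(3)[of L] L by (auto simp: E_def)
    obtain y where y: "in_kernel (bmat X) (N - {i0}) S y" "sum y (ones X S i0) \<noteq> 0"
      using essential[OF i0(1)] by blast
    \<comment> \<open>\<open>y\<close> solves all rows but the one of the closing edge; its ratio to \<open>x\<close> propagates along the path\<close>
    define c where "c = y (vs ! 0) / x (vs ! 0)"
    have inS: "vs ! i \<in> S" if "i \<le> L" for i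
      using edge[OF vs(3)[of i]] that L by auto
    have "y (vs ! i) = c * x (vs ! i)" if "i \<le> L" for i
      using that
    proof (induction i)
      case 0 then show ?case using xnz[OF inS[of 0]] by (simp add: c_def)
    next
      case (Suc i)
      then have "{vs ! i, vs ! Suc i} \<in> E" using vs(3)[of i] L by simp
      then obtain i' where i': "i' \<in> N" "ones X S i' = {vs ! i, vs ! Suc i}"
        by (auto simp: E_def)
      have ne: "vs ! i \<noteq> vs ! Suc i" using vs(2) Suc.prems L by (simp add: nth_eq_iff_index_eq)
      have "i' \<noteq> i0"
      proof
        assume "i' = i0"
        then have "{vs ! i, vs ! Suc i} = {vs ! L, vs ! 0}" using i0 i' by simp
        then show False using vs(2) Suc.prems L by (auto simp: doubleton_eq_iff nth_eq_iff_index_eq)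
      qed
      then have "sum y (ones X S i') = 0" using y(1) i'(1) unfolding ker by blast
      then have "y (vs ! i) + y (vs ! Suc i) = 0" using i' ne by simp
      moreover have "x (vs ! i) + x (vs ! Suc i) = 0" using xker[OF i'(1)] i' ne by simp
      ultimately show ?case using Suc by (simp add: add_eq_0_iff)
    qed
    then have "sum y (ones X S i0) = c * sum x (ones X S i0)"
      unfolding sum_distrib_left by (intro sum.cong) (auto simp: i0)
    with xker[OF i0(1)] y(2) show False by simp
  qed
  with simple connected show "is_tree S (ones X S ` N)"
    by (simp add: is_tree_def E_def)
qed


section \<open>Minimal dependencies as circuits\<close>

text \<open>
  The rank condition provides \<open>k - 1\<close> linearly independent columns, all but one. A kernel vector that
  vanishes at the remaining column is therefore zero, and every kernel vector can be brought to this
  form by subtracting a multiple of \<open>x\<close>.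
\<close>
lemma minimal_dependency_circuit:
  assumes M: "M \<in> carrier_mat n k" and dep: "minimal_dependency M"
  shows "\<exists>x. is_circuit (\<lambda>i j. M $$ (i, j)) {..<n} {..<k} x"
proof -
  interpret V: vec_space "TYPE(real)" n .
  have dims: "dim_row M = n" "dim_col M = k" using M by auto
  obtain x where x: "x \<in> carrier_vec k" "M *\<^sub>v x = 0\<^sub>v n" "{j. j < k \<and> x $ j \<noteq> 0} = {..<k}"
    and rank: "V.rank M + 1 = k"
    using dep unfolding minimal_dependency_def dims by blast
  have xnz: "x $ j \<noteq> 0" if "j < k" for j using x(3) that by blast
  have xker: "(\<Sum>j<k. M $$ (i, j) * x $ j) = 0" if "i < n" for i
  proof -
    have "(M *\<^sub>v x) $ i = (\<Sum>j<k. M $$ (i, j) * x $ j)"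
      using M x(1) that by (simp add: scalar_prod_def atLeast0LessThan)
    then show ?thesis using x(2) that by simp
  qed
  have cols: "set (cols M) = col M ` {..<k}"
    using dims by (auto simp: cols_def)
  have "V.lin_indpt {}" by (rule V.finite_lin_indpt2) auto
  then have "\<exists>U. finite U \<and> maximal U (\<lambda>T. T \<subseteq> set (cols M) \<and> V.lin_indpt T) \<and> {} \<subseteq> U"
    by (intro maximal_exists_superset[of "set (cols M)"]) simp_all
  then obtain U where U: "maximal U (\<lambda>T. T \<subseteq> set (cols M) \<and> V.lin_indpt T)" "finite U"
    by blast
  then have indpt: "U \<subseteq> col M ` {..<k}" "V.lin_indpt U" by (auto simp: maximal_def cols)
  have cardU: "card U + 1 = k" using V.rank_card_indpt[OF M U(1)] rank by simp
  obtain T where T: "T \<subseteq> {..<k}" "inj_on (col M) T" "col M ` T = U"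
    using indpt(1) unfolding subset_image_inj by blast
  have finT: "finite T" using T(1) finite_subset by blast
  have "card T + 1 = k" using card_image[OF T(2)] cardU T(3) by simp
  then have "card ({..<k} - T) = 1" using T(1) finT by (simp add: card_Diff_subset)
  then obtain t where t: "{..<k} - T = {t}" by (auto simp: card_1_singleton_iff)
  then have tk: "t < k" and ins: "{..<k} = insert t T" and tT: "t \<notin> T" using T(1) by blast+
  have zero: "z j = 0" if z: "\<And>i. i < n \<Longrightarrow> (\<Sum>j<k. M $$ (i, j) * z j) = 0" and "z t = 0" "j < k" for z j
  proof (rule ccontr)
    assume nz: "z j \<noteq> 0"
    moreover have "j \<in> insert t T" using \<open>j < k\<close> unfolding ins[symmetric] by simp
    ultimately have jT: "j \<in> T" using \<open>z t = 0\<close> by auto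
    \<comment> \<open>linear combinations are indexed by the column vectors themselves, which is harmless on \<open>T\<close>, where columns are distinct\<close>
    define c where "c = (\<lambda>u. z (the_inv_into T (col M) u))"
    have c: "c (col M j) = z j" if "j \<in> T" for j
      using that T(2) by (simp add: c_def the_inv_into_f_f)
    have Uc: "U \<subseteq> carrier_vec n" using indpt(1) dims by (auto simp: col_def)
    have "V.lincomb c U = 0\<^sub>v n"
    proof (rule eq_vecI)
      fix i assume "i < dim_vec (0\<^sub>v n :: real vec)"
      then have i: "i < n" by simp
      have "V.lincomb c U $ i = (\<Sum>u\<in>U. c u * u $ i)"
        by (rule V.lincomb_index[OF i Uc])
      also have "\<dots> = (\<Sum>j\<in>T. c (col M j) * col M j $ i)"
        using T(2,3) by (metis (no_types, lifting) sum.reindex_cong)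
      also have "\<dots> = (\<Sum>j\<in>T. M $$ (i, j) * z j)"
        using T(1) i dims by (intro sum.cong) (auto simp: c)
      also have "\<dots> = (\<Sum>j<k. M $$ (i, j) * z j)"
        unfolding ins using finT tT \<open>z t = 0\<close> by simp
      finally show "V.lincomb c U $ i = 0\<^sub>v n $ i" using z[OF i] i by simp
    qed (use Uc V.lincomb_dim[OF \<open>finite U\<close> Uc] in simp)
    moreover have "c (col M j) \<noteq> 0" using c[OF jT] nz by simp
    ultimately have "V.lin_dep U"
      unfolding V.lin_dep_def using \<open>finite U\<close> jT T(3)
      by (intro exI[of _ U] exI[of _ c] exI[of _ "col M j"]) auto
    with indpt(2) show False by simp
  qed
  have "is_circuit (\<lambda>i j. M $$ (i, j)) {..<n} {..<k} (\<lambda>j. x $ j)"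
    unfolding is_circuit_def in_kernel_def
  proof (intro conjI allI impI ballI)
    fix y assume y: "\<forall>i\<in>{..<n}. (\<Sum>j<k. M $$ (i, j) * y j) = 0"
    define c where "c = y t / x $ t"
    have "y j - c * x $ j = 0" if "j < k" for j
    proof (rule zero[OF _ _ that])
      fix i assume "i < n"
      then show "(\<Sum>j<k. M $$ (i, j) * (y j - c * x $ j)) = 0"
        using y xker[of i] by (simp add: right_diff_distrib sum_subtractf mult.left_commute[of _ c] sum_distrib_left[symmetric])
    qed (use xnz[OF tk] in \<open>simp add: c_def\<close>)
    then show "\<exists>c. \<forall>j\<in>{..<k}. y j = c * x $ j" by (intro exI[of _ c]) auto
  qed (use xnz xker in auto)
  then show ?thesis by blast
qed

lemma card_ones_total:
  assumes "finite I" "finite S"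
  shows "card {(i, j). i \<in> I \<and> j \<in> S \<and> X i j} = (\<Sum>i\<in>I. card (ones X S i))"
proof -
  have "{(i, j). i \<in> I \<and> j \<in> S \<and> X i j} = (SIGMA i:I. ones X S i)"
    by (auto simp: ones_def)
  then show ?thesis using assms by (simp add: card_SigmaI ones_def)
qed

lemma graphic_circuit_tree_dependency:
  assumes M: "M \<in> carrier_mat n k"
    and X: "\<And>i j. i < n \<Longrightarrow> j < k \<Longrightarrow> M $$ (i, j) = of_bool (X i j)"
    and circ: "is_circuit (\<lambda>i j. M $$ (i, j)) {..<n} {..<k} x"
    and gr: "graphic X {..<n} {..<k}"
  shows "M \<in> tree_dependencies k"
proof -
  define N where "N = {i \<in> {..<n}. ones X {..<k} i \<noteq> {}}"
  have "in_kernel (\<lambda>i j. M $$ (i, j)) {..<n} {..<k} y = in_kernel (bmat X) {..<n} {..<k} y" for y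
    unfolding in_kernel_def using X by (intro ball_cong sum.cong refl arg_cong2[of _ _ _ _ "(=)"]) auto
  with circ have circ': "is_circuit (bmat X) {..<n} {..<k} x"
    unfolding is_circuit_def by blast
  note tree = circuit_graphic_is_tree[OF circ' _ _ gr, folded N_def]
  have dims: "dim_row M = n" "dim_col M = k" using M by auto
  have row: "row M i \<noteq> 0\<^sub>v k \<longleftrightarrow> ones X {..<k} i \<noteq> {}" if "i < n" for i
    using that X dims by (auto simp: vec_eq_iff ones_def split: if_splits)
  have N: "{i. i < dim_row M \<and> row M i \<noteq> 0\<^sub>v k} = N"
    using row dims by (auto simp: N_def)
  have one: "M $$ (i, j) = 1 \<longleftrightarrow> X i j" if "i < n" "j < k" for i j using X that by simp
  have "{(i, j). i < dim_row M \<and> j < k \<and> M $$ (i, j) = 1} = {(i, j). i \<in> {..<n} \<and> j \<in> {..<k} \<and> X i j}"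
    using one dims by auto
  also have "card \<dots> = (\<Sum>i<n. card (ones X {..<k} i))"
    by (rule card_ones_total) auto
  also have "\<dots> = (\<Sum>i\<in>N. card (ones X {..<k} i))"
    by (rule sum.mono_neutral_right) (auto simp: N_def)
  also have "\<dots> = (\<Sum>i\<in>N. 2)"
    using gr by (intro sum.cong) (auto simp: graphic_def N_def)
  also have "\<dots> = 2 * card N" by simp
  finally have "card {(i, j). i < dim_row M \<and> j < k \<and> M $$ (i, j) = 1} + 2 = 2 * k"
    using gr by (simp add: graphic_def N_def)
  moreover have "bij_betw (ones X {..<k}) {i. i < dim_row M \<and> row M i \<noteq> 0\<^sub>v k} (ones X {..<k} ` N)"
    unfolding N using tree(1) by (simp add: inj_on_imp_bij_betw)
  moreover have "is_tree {..<k} (ones X {..<k} ` N)" using tree(2) by simp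
  moreover have "M $$ (i, j) = of_bool (j \<in> ones X {..<k} i)" if "i < n" "j < k" for i j
    using X that by (simp add: ones_def)
  ultimately show ?thesis
    unfolding tree_dependencies_def using dims X by auto
qed

abbreviation bool_mat :: "nat \<Rightarrow> (nat \<Rightarrow> nat \<Rightarrow> bool) \<Rightarrow> real mat" where
  "bool_mat n X \<equiv> Matrix.mat n n (\<lambda>(i, j). of_bool (X i j))"

lemma bij_betw_pick:
  assumes "finite S"
  shows "bij_betw (pick S) {..<card S} S"
  unfolding bij_betw_def
proof
  show inj: "inj_on (pick S) {..<card S}"
    by (rule inj_onI) (metis lessThan_iff linorder_neqE_nat nat_neq_iff pick_mono)
  show "pick S ` {..<card S} = S"
    by (rule card_subset_eq) (use assms inj in \<open>auto simp: card_image intro: pick_in_set_le\<close>)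
qed

text \<open>
  The only point of contact with the matrix formalism: from here on a random matrix is a function
  \<open>X\<close> of row and column, and a column set is just a set of numbers.
\<close>
lemma non_tree_dependency_circuit:
  assumes "\<not> only_tree_dependencies (bool_mat n X)"
  shows "\<exists>S x. S \<subseteq> {..<n} \<and> S \<noteq> {} \<and> is_circuit (bmat X) {..<n} S x \<and> \<not> graphic X {..<n} S"
proof -
  let ?B = "bool_mat n X"
  obtain S where S: "S \<subseteq> {..<n}" and dep: "minimal_dependency (columns_submat ?B S)"
    and nt: "columns_submat ?B S \<notin> tree_dependencies (card S)"
    using assms unfolding only_tree_dependencies_def by auto
  define k where "k = card S"
  let ?M = "columns_submat ?B S"
  have finS: "finite S" using S finite_subset by blast
  have "{j. j < n \<and> j \<in> S} = S" using S by auto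
  then have cardS: "card {j. j < n \<and> j \<in> S} = k" by (simp only: k_def)
  have M: "?M \<in> carrier_mat n k" by (intro carrier_matI) (simp_all add: dim_submatrix cardS)
  have bij: "bij_betw (pick S) {..<k} S" unfolding k_def by (rule bij_betw_pick[OF finS])
  have entry: "?M $$ (i, j) = of_bool (X i (pick S j))" if "i < n" "j < k" for i j
  proof -
    have "pick S j \<in> S" using bij that by (auto simp: bij_betw_def)
    then have "pick S j < n" using S by auto
    then show ?thesis using that
      by (subst submatrix_index) (simp_all add: cardS pick_UNIV)
  qed
  obtain x where circ: "is_circuit (\<lambda>i j. ?M $$ (i, j)) {..<n} {..<k} x"
    using minimal_dependency_circuit[OF M dep] by blast
  have ng: "\<not> graphic (\<lambda>i j. X i (pick S j)) {..<n} {..<k}"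
    using graphic_circuit_tree_dependency[OF M entry circ] nt by (auto simp: k_def)
  have "in_kernel (\<lambda>i j. ?M $$ (i, j)) {..<n} {..<k} y = in_kernel (\<lambda>i j. bmat X i (pick S j)) {..<n} {..<k} y" for y
    unfolding in_kernel_def using entry by (intro ball_cong sum.cong refl arg_cong2[of _ _ _ _ "(=)"]) auto
  with circ have "is_circuit (\<lambda>i j. bmat X i (pick S j)) {..<n} {..<k} x"
    unfolding is_circuit_def by simp
  from is_circuit_reindex[OF bij this] have "is_circuit (bmat X) {..<n} S (x \<circ> inv_into {..<k} (pick S))" .
  moreover have "\<not> graphic X {..<n} S"
  proof -
    have "ones X S i = pick S ` ones (\<lambda>i j. X i (pick S j)) {..<k} i" for i
      using bij by (auto simp: ones_def bij_betw_def)
    then have "card (ones X S i) = card (ones (\<lambda>i j. X i (pick S j)) {..<k} i)"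
      "ones X S i = {} \<longleftrightarrow> ones (\<lambda>i j. X i (pick S j)) {..<k} i = {}" for i
      using bij by (auto simp: bij_betw_def ones_def intro!: card_image elim: inj_on_subset)
    then show ?thesis using ng by (simp add: graphic_def k_def)
  qed
  moreover have "S \<noteq> {}"
  proof
    assume "S = {}"
    then have "dim_col ?M = 0" using M by (simp add: k_def)
    then show False using dep by (simp add: minimal_dependency_def)
  qed
  ultimately show ?thesis using S by blast
qed

section \<open>The Littlewood-Offord inequality for biased coins\<close>

text \<open>
  \<open>middle_binomial m 0 \<ge> middle_binomial m 1 \<ge> \<dots>\<close> lists the binomial coefficients of order \<open>m\<close> in
  decreasing order, so \<open>middle_layers m r\<close> is the sum of the \<open>r\<close> largest ones.
\<close>
definition middle_binomial :: "nat \<Rightarrow> nat \<Rightarrow> nat" where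
  "middle_binomial m j = m choose ((m + j + 1) div 2)"

definition middle_layers :: "nat \<Rightarrow> nat \<Rightarrow> nat" where
  "middle_layers m r = (\<Sum>j<r. middle_binomial m j)"

lemma middle_layers_Suc: "middle_layers m (Suc r) = middle_layers m r + middle_binomial m r"
  by (simp add: middle_layers_def)

lemma middle_binomial_antimono: "middle_binomial m (Suc j) \<le> middle_binomial m j"
proof (cases "(m + j + 2) div 2 \<le> m")
  case True
  then show ?thesis unfolding middle_binomial_def by (intro binomial_antimono) auto
qed (simp add: middle_binomial_def binomial_eq_0)

lemma middle_binomial_recursion:
  "middle_binomial (Suc m) (Suc j) = middle_binomial m j + middle_binomial m (Suc (Suc j))"
  "middle_binomial (Suc m) 0 = middle_binomial m 0 + middle_binomial m 1"
proof -
  have "(Suc m + Suc j + 1) div 2 = Suc ((m + j + 1) div 2)"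
    "(m + Suc (Suc j) + 1) div 2 = Suc ((m + j + 1) div 2)" by simp_all
  then show "middle_binomial (Suc m) (Suc j) = middle_binomial m j + middle_binomial m (Suc (Suc j))"
    unfolding middle_binomial_def by simp
  have "m choose ((m + 1) div 2) = m choose (m div 2)"
    using binomial_symmetric[of "(m + 1) div 2" m] by (cases "even m") (auto elim!: evenE oddE)
  moreover have "(Suc m + 0 + 1) div 2 = Suc (m div 2)" "(m + 1 + 1) div 2 = Suc (m div 2)" by simp_all
  ultimately show "middle_binomial (Suc m) 0 = middle_binomial m 0 + middle_binomial m 1"
    unfolding middle_binomial_def by simp
qed

lemma middle_layers_recursion:
  "middle_layers (Suc m) (Suc r) = middle_layers m (Suc (Suc r)) + middle_layers m r"
proof (induction r)
  case 0
  show ?case using middle_binomial_recursion(2)[of m]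
    by (simp add: middle_layers_Suc middle_layers_def[of _ 0])
next
  case (Suc r)
  then show ?case using middle_binomial_recursion(1)[of m r]
    by (simp add: middle_layers_Suc[of "Suc m" "Suc r"] middle_layers_Suc[of m "Suc (Suc r)"] middle_layers_Suc[of m r])
qed

text \<open>
  Concavity in \<open>r\<close>, in the form in which it is needed: among pairs with a fixed sum, spreading out
  the two arguments decreases the sum of the values.
\<close>
lemma middle_layers_concave:
  "t \<le> r \<Longrightarrow> middle_layers m (Suc (Suc r) + t) + middle_layers m (r - t)
     \<le> middle_layers m (Suc (Suc r)) + middle_layers m r"
proof (induction t)
  case (Suc t)
  have "antimono (middle_binomial m)"
    by (rule decseq_SucI) (rule middle_binomial_antimono)
  then have "middle_binomial m (Suc (Suc r) + t) \<le> middle_binomial m (r - Suc t)"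
    by (rule antimonoD) simp
  moreover have "Suc (r - Suc t) = r - t" using Suc.prems by simp
  then have "middle_layers m (r - t) = middle_layers m (r - Suc t) + middle_binomial m (r - Suc t)"
    using middle_layers_Suc[of m "r - Suc t"] by simp
  moreover have "middle_layers m (Suc (Suc r) + Suc t) = middle_layers m (Suc (Suc r) + t) + middle_binomial m (Suc (Suc r) + t)"
    using middle_layers_Suc[of m "Suc (Suc r) + t"] by simp
  ultimately show ?case using Suc by linarith
qed simp

text \<open>
  Erdos' theorem for several target values. Whether \<open>i\<close> is used or not, a sum over a subset of
  \<open>insert i I\<close> hits \<open>V\<close> exactly if the sum over the rest hits \<open>V\<close> or its translate \<open>W\<close>. Inclusion and
  exclusion replaces \<open>V\<close> and \<open>W\<close> by their union and intersection. The translate differs from \<open>V\<close>, so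
  these have at least \<open>|V| + 1\<close> and at most \<open>|V| - 1\<close> elements, respectively, and concavity gives the
  recursion of \<open>middle_layers\<close>. Allowing sets \<open>V\<close> is what makes the induction work, and it
  makes the signs of the \<open>x i\<close> irrelevant.
\<close>
lemma card_subset_sums_le:
  fixes x :: "'a \<Rightarrow> real"
  assumes "finite I" "\<And>i. i \<in> I \<Longrightarrow> x i \<noteq> 0" "finite V"
  shows "card {A \<in> Pow I. sum x A \<in> V} \<le> middle_layers (card I) (card V)"
  using assms
proof (induction I arbitrary: V rule: finite_induct)
  case empty
  show ?case
  proof (cases "V = {}")
    case False
    then obtain r where r: "card V = Suc r" using empty by (metis card_0_eq not0_implies_Suc)
    have "middle_layers 0 (Suc r) \<ge> middle_binomial 0 0"
      unfolding middle_layers_def by (rule member_le_sum) auto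
    moreover have "card {A \<in> Pow {}. sum x A \<in> V} \<le> card {{} :: 'a set}" by (intro card_mono) auto
    ultimately show ?thesis by (simp add: r middle_binomial_def)
  qed simp
next
  case (insert i I)
  let ?N = "\<lambda>V. {A \<in> Pow I. sum x A \<in> V}"
  show ?case
  proof (cases "V = {}")
    case False
    define W where "W = (\<lambda>v. v - x i) ` V"
    have W: "finite W" "card W = card V" using insert by (auto simp: W_def card_image inj_on_def)
    obtain r where r: "card V = Suc r" using insert.prems False by (metis card_0_eq not0_implies_Suc)
    have "V \<noteq> W"
    proof
      assume "V = W"
      have "\<Sum>W = (\<Sum>v\<in>V. v - x i)" unfolding W_def by (subst sum.reindex) (auto simp: inj_on_def)
      then have "real (card V) * x i = 0" using \<open>V = W\<close> by (simp add: sum_subtractf)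
      then show False using insert.prems r by simp
    qed
    have UI: "card (V \<union> W) + card (V \<inter> W) = 2 * Suc r"
      using card_Un_Int[of V W] W insert.prems r by simp
    have "card (V \<inter> W) < card V"
      using \<open>V \<noteq> W\<close> W insert.prems by (metis card_subset_eq inf.cobounded1 inf.cobounded2 psubset_card_mono psubsetI)
    then have "card (V \<inter> W) \<le> r" using r by simp
    define t where "t = r - card (V \<inter> W)"
    have t: "t \<le> r" "card (V \<inter> W) = r - t" "card (V \<union> W) = Suc (Suc r) + t"
      using UI \<open>card (V \<inter> W) \<le> r\<close> by (auto simp: t_def)
    have split: "{A \<in> Pow (insert i I). sum x A \<in> V} = ?N V \<union> Set.insert i ` ?N W"
    proof (intro equalityI subsetI)
      fix A assume A: "A \<in> {A \<in> Pow (insert i I). sum x A \<in> V}"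
      show "A \<in> ?N V \<union> Set.insert i ` ?N W"
      proof (cases "i \<in> A")
        case True
        have "finite A" using A insert.hyps finite_subset by blast
        with True have "sum x (A - {i}) = sum x A - x i" by (simp add: sum_diff1)
        then have "A - {i} \<in> ?N W" using A by (auto simp: W_def)
        then show ?thesis using True by (auto intro!: image_eqI[of _ _ "A - {i}"])
      qed (use A in auto)
    next
      fix A assume "A \<in> ?N V \<union> Set.insert i ` ?N W"
      then show "A \<in> {A \<in> Pow (insert i I). sum x A \<in> V}"
      proof
        assume "A \<in> Set.insert i ` ?N W"
        then obtain A' v where A': "A' \<subseteq> I" "sum x A' = v - x i" "v \<in> V" "A = Set.insert i A'"
          by (auto simp: W_def)
        then have "finite A'" "i \<notin> A'" using insert.hyps finite_subset by auto
        then have "sum x A = v" using A' by simp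
        then show ?thesis using A' by auto
      qed auto
    qed
    have fin: "finite (?N U)" for U using insert.hyps by simp
    have "card {A \<in> Pow (insert i I). sum x A \<in> V} \<le> card (?N V) + card (Set.insert i ` ?N W)"
      unfolding split by (rule card_Un_le)
    also have "\<dots> \<le> card (?N V) + card (?N W)" using card_image_le[OF fin] by simp
    also have "\<dots> = card (?N V \<union> ?N W) + card (?N V \<inter> ?N W)"
      by (rule card_Un_Int[OF fin fin])
    also have "?N V \<union> ?N W = ?N (V \<union> W)" by auto
    also have "?N V \<inter> ?N W = ?N (V \<inter> W)" by auto
    also have "card (?N (V \<union> W)) + card (?N (V \<inter> W))
        \<le> middle_layers (card I) (card (V \<union> W)) + middle_layers (card I) (card (V \<inter> W))"
      by (intro add_mono insert.IH) (use insert.prems W in auto)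
    also have "\<dots> \<le> middle_layers (card I) (Suc (Suc r)) + middle_layers (card I) r"
      unfolding t(2,3) by (rule middle_layers_concave[OF t(1)])
    also have "\<dots> = middle_layers (card (insert i I)) (card V)"
      using insert.hyps by (simp add: r middle_layers_recursion)
    finally show ?thesis .
  qed simp
qed

lemma central_binomial_upper: "(real ((2 * j) choose j))\<^sup>2 * (2 * real j + 1) \<le> 16 ^ j"
proof (induction j)
  case (Suc j)
  let ?c = "real ((2 * j) choose j)" and ?c' = "real ((2 * Suc j) choose Suc j)"
  have c: "?c = fact (2 * j) / (fact j * fact j)"
    using binomial_fact[of j "2 * j", where 'a = real] by (simp del: binomial_Suc_Suc)
  have c': "?c' = fact (Suc (Suc (2 * j))) / (fact (Suc j) * fact (Suc j))"
    using binomial_fact[of "Suc j" "2 * Suc j", where 'a = real] by (simp del: binomial_Suc_Suc fact_Suc)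
  have eq: "(real j + 1) * ?c' = 2 * (2 * real j + 1) * ?c"
    unfolding c c' fact_Suc by (simp add: divide_simps) (simp add: algebra_simps)
  have "(real j + 1)\<^sup>2 * (?c'\<^sup>2 * (2 * real (Suc j) + 1)) = ((real j + 1) * ?c')\<^sup>2 * (2 * real j + 3)"
    by (simp add: power_mult_distrib)
  also have "\<dots> = (?c\<^sup>2 * (2 * real j + 1)) * (4 * (2 * real j + 1) * (2 * real j + 3))"
    unfolding eq by (simp add: power_mult_distrib power2_eq_square algebra_simps)
  also have "\<dots> \<le> 16 ^ j * (16 * (real j + 1)\<^sup>2)"
    by (rule mult_mono[OF Suc.IH]) (auto simp: power2_eq_square algebra_simps)
  finally have "(real j + 1)\<^sup>2 * (?c'\<^sup>2 * (2 * real (Suc j) + 1)) \<le> (real j + 1)\<^sup>2 * 16 ^ Suc j"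
    by (simp add: mult_ac)
  then show ?case by (rule mult_left_le_imp_le) simp
qed simp

lemma middle_binomial_upper: "real (middle_binomial m 0) / 2 ^ m \<le> 1 / sqrt (real m + 1)"
proof -
  have "(real (middle_binomial m 0))\<^sup>2 * (real m + 1) \<le> (2 ^ m)\<^sup>2"
  proof (cases "even m")
    case True
    then obtain j where m: "m = 2 * j" by (elim evenE)
    have "(2 :: real) ^ m = 4 ^ j" by (simp add: m power_mult)
    then have "((2 :: real) ^ m)\<^sup>2 = 16 ^ j" by (simp add: power2_eq_square power_mult_distrib[symmetric])
    then show ?thesis using central_binomial_upper[of j] by (simp add: middle_binomial_def m)
  next
    case False
    then obtain j where m: "m = 2 * j + 1" by (elim oddE)
    have "(2 :: real) ^ m = 2 * 4 ^ j" by (simp add: m power_mult)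
    then have pow: "((2 :: real) ^ m)\<^sup>2 = 16 ^ Suc j / 4" by (simp add: power2_eq_square power_mult_distrib[symmetric])
    have "(2 * Suc j) choose Suc j = 2 * (m choose Suc j)"
      using binomial_symmetric[of j m] by (simp add: m)
    moreover have "real (middle_binomial m 0) = real (m choose Suc j)"
      by (simp add: middle_binomial_def m del: binomial_Suc_Suc)
    ultimately have C: "real ((2 * Suc j) choose Suc j) = 2 * real (middle_binomial m 0)"
      by (simp del: binomial_Suc_Suc)
    have "(2 * real (middle_binomial m 0))\<^sup>2 * (real m + 1) \<le> (2 * real (middle_binomial m 0))\<^sup>2 * (2 * real (Suc j) + 1)"
      by (intro mult_left_mono) (auto simp: m)
    also have "\<dots> \<le> 16 ^ Suc j"
      using central_binomial_upper[of "Suc j"] unfolding C .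
    finally show ?thesis unfolding pow by (simp add: power_mult_distrib mult.commute)
  qed
  then have "sqrt ((real (middle_binomial m 0))\<^sup>2 * (real m + 1)) \<le> sqrt ((2 ^ m)\<^sup>2)"
    by (rule real_sqrt_le_mono)
  then have "real (middle_binomial m 0) * sqrt (real m + 1) \<le> 2 ^ m"
    unfolding real_sqrt_mult real_sqrt_abs by simp
  then show ?thesis by (simp add: field_simps)
qed

lemma erdos_littlewood_offord:
  fixes x :: "'a \<Rightarrow> real"
  assumes "finite I" "\<And>i. i \<in> I \<Longrightarrow> x i \<noteq> 0"
  shows "real (card {A \<in> Pow I. sum x A = a}) / 2 ^ card I \<le> 1 / sqrt (real (card I) + 1)"
proof -
  have "card {A \<in> Pow I. sum x A = a} \<le> middle_binomial (card I) 0"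
    using card_subset_sums_le[OF assms, where V = "{a}"] by (simp add: middle_layers_def)
  then have "real (card {A \<in> Pow I. sum x A = a}) / 2 ^ card I \<le> real (middle_binomial (card I) 0) / 2 ^ card I"
    by (intro divide_right_mono) auto
  also have "\<dots> \<le> 1 / sqrt (real (card I) + 1)" by (rule middle_binomial_upper)
  finally show ?thesis .
qed

lemma sum_Pow_insert:
  assumes "finite I" "i \<notin> I"
  shows "(\<Sum>A\<in>Pow (insert i I). f A) = (\<Sum>A\<in>Pow I. f A) + (\<Sum>A\<in>Pow I. f (insert i A))"
proof -
  have "inj_on (insert i) (Pow I)" using assms by (auto simp: inj_on_def)
  then show ?thesis
    unfolding Pow_insert using assms by (subst sum.union_disjoint) (auto simp: sum.reindex)
qed

text \<open>
  A biased coin with success probability \<open>p\<close> can be tossed in two stages: with probability \<open>2 p\<close>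
  toss a fair coin, otherwise fail. Here \<open>M\<close> is the set of positions that receive a fair coin.
\<close>
lemma bernoulli_set_expectation:
  fixes g :: "'a set \<Rightarrow> real"
  assumes "finite I" "0 \<le> p" "p \<le> 1 / 2"
  shows "measure_pmf.expectation (Pi_pmf I False (\<lambda>_. bernoulli_pmf p)) (\<lambda>Y. g {i \<in> I. Y i}) =
     (\<Sum>M\<in>Pow I. (2 * p) ^ card M * (1 - 2 * p) ^ card (I - M) * ((\<Sum>A\<in>Pow M. g A) / 2 ^ card M))"
  using assms(1)
proof (induction I arbitrary: g rule: finite_induct)
  case empty
  then show ?case by simp
next
  case (insert i I)
  let ?P = "Pi_pmf I False (\<lambda>_. bernoulli_pmf p)"
  let ?E = "\<lambda>g. measure_pmf.expectation ?P (\<lambda>Y. g {i \<in> I. Y i})"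
  define t where "t = (\<lambda>(g :: 'a set \<Rightarrow> real) M. (2 * p) ^ card M * (1 - 2 * p) ^ card (I - M) * ((\<Sum>A\<in>Pow M. g A) / 2 ^ card M))"
  define R where "R = (\<lambda>g. \<Sum>M\<in>Pow I. t g M)"
  have set1: "{j \<in> insert i I. (Y(i := b)) j} = (if b then insert i {j \<in> I. Y j} else {j \<in> I. Y j})" for Y b
    using insert.hyps by auto
  have fin: "finite (set_pmf ?P)"
    using insert.hyps by (simp add: set_Pi_pmf finite_PiE_dflt)
  have "measure_pmf.expectation (Pi_pmf (insert i I) False (\<lambda>_. bernoulli_pmf p)) (\<lambda>Y. g {j \<in> insert i I. Y j})
      = (\<Sum>b\<in>UNIV. pmf (bernoulli_pmf p) b *\<^sub>R measure_pmf.expectation (map_pmf (\<lambda>Y. Y(i := b)) ?P) (\<lambda>Y. g {j \<in> insert i I. Y j}))"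
    unfolding Pi_pmf_insert'[OF insert.hyps] map_pmf_def[symmetric]
    using fin by (intro pmf_expectation_bind) auto
  also have "\<dots> = p * ?E (\<lambda>A. g (insert i A)) + (1 - p) * ?E g"
    unfolding integral_map_pmf set1 using assms by (simp add: UNIV_bool)
  also have "\<dots> = p * R (\<lambda>A. g (insert i A)) + (1 - p) * R g"
    unfolding R_def t_def insert.IH[of g] insert.IH[of "\<lambda>A. g (insert i A)"] by (rule refl)
  also have "\<dots> = (1 - 2 * p) * R g + (p * R g + p * R (\<lambda>A. g (insert i A)))"
    by (simp add: algebra_simps)
  also have "(1 - 2 * p) * R g = (\<Sum>M\<in>Pow I. (2 * p) ^ card M * (1 - 2 * p) ^ card (insert i I - M) * ((\<Sum>A\<in>Pow M. g A) / 2 ^ card M))"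
    unfolding R_def sum_distrib_left
  proof (intro sum.cong refl)
    fix M assume "M \<in> Pow I"
    then have "i \<notin> M" "finite M" using insert.hyps by (auto intro: finite_subset)
    then have "card (insert i I - M) = Suc (card (I - M))" using insert.hyps by (simp add: insert_Diff_if)
    then show "(1 - 2 * p) * t g M =
       (2 * p) ^ card M * (1 - 2 * p) ^ card (insert i I - M) * ((\<Sum>A\<in>Pow M. g A) / 2 ^ card M)"
      by (simp add: t_def)
  qed
  also have "p * R g + p * R (\<lambda>A. g (insert i A)) = (\<Sum>M\<in>Pow I. p * t g M + p * t (\<lambda>A. g (insert i A)) M)"
    by (simp add: R_def sum.distrib sum_distrib_left)
  also have "\<dots> = (\<Sum>M\<in>Pow I. (2 * p) ^ card (insert i M) * (1 - 2 * p) ^ card (insert i I - insert i M) *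
      ((\<Sum>A\<in>Pow (insert i M). g A) / 2 ^ card (insert i M)))"
  proof (intro sum.cong refl)
    fix M assume "M \<in> Pow I"
    then have M: "finite M" "i \<notin> M" using insert.hyps by (auto intro: finite_subset)
    have "insert i I - insert i M = I - M" "card (insert i M) = Suc (card M)" using insert.hyps M by auto
    then show "p * t g M + p * t (\<lambda>A. g (insert i A)) M =
       (2 * p) ^ card (insert i M) * (1 - 2 * p) ^ card (insert i I - insert i M) * ((\<Sum>A\<in>Pow (insert i M). g A) / 2 ^ card (insert i M))"
      by (simp add: t_def sum_Pow_insert[OF M] add_divide_distrib distrib_left)
  qed
  finally show ?case using insert.hyps by (simp add: sum_Pow_insert)
qed

lemma sum_Pow_card:
  fixes f :: "nat \<Rightarrow> real"
  assumes "finite I"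
  shows "(\<Sum>M\<in>Pow I. f (card M)) = (\<Sum>m\<le>card I. real (card I choose m) * f m)"
proof -
  have "(\<Sum>M\<in>Pow I. f (card M)) = (\<Sum>m\<le>card I. \<Sum>M\<in>{M\<in>Pow I. card M = m}. f (card M))"
    using assms by (intro sum.group[symmetric]) (auto intro: card_mono)
  also have "\<dots> = (\<Sum>m\<le>card I. real (card I choose m) * f m)"
    using n_subsets[OF assms] by (intro sum.cong) auto
  finally show ?thesis .
qed

text \<open>
  The expectation of \<open>1 / (N + 1)\<close> for a binomial variable \<open>N\<close>: absorbing \<open>m + 1\<close> into the binomial
  coefficient turns the sum into a part of the binomial expansion of order \<open>k + 1\<close>.
\<close>
lemma binomial_reciprocal_moment:
  fixes q :: real
  assumes "0 < q" "q \<le> 1"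
  shows "(\<Sum>m\<le>k. real (k choose m) * (q ^ m * (1 - q) ^ (k - m) / (real m + 1))) \<le> 1 / (q * (real k + 1))"
proof -
  have "q * (real k + 1) * (\<Sum>m\<le>k. real (k choose m) * (q ^ m * (1 - q) ^ (k - m) / (real m + 1)))
      = (\<Sum>m\<le>k. real (Suc k choose Suc m) * q ^ Suc m * (1 - q) ^ (Suc k - Suc m))"
    unfolding sum_distrib_left
  proof (intro sum.cong refl)
    fix m
    have "real (Suc k * (k choose m)) = real ((Suc k choose Suc m) * Suc m)"
      by (simp only: Suc_times_binomial_eq)
    then have "(real k + 1) * real (k choose m) = real (Suc k choose Suc m) * (real m + 1)"
      by (simp only: of_nat_mult of_nat_Suc add.commute)
    then have "real (Suc k choose Suc m) = (real k + 1) * real (k choose m) / (real m + 1)"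
      by (simp only: eq_divide_eq) auto
    then show "q * (real k + 1) * (real (k choose m) * (q ^ m * (1 - q) ^ (k - m) / (real m + 1))) =
       real (Suc k choose Suc m) * q ^ Suc m * (1 - q) ^ (Suc k - Suc m)"
      by simp
  qed
  also have "\<dots> \<le> (\<Sum>m\<le>Suc k. real (Suc k choose m) * q ^ m * (1 - q) ^ (Suc k - m))"
    unfolding sum.atMost_Suc_shift using assms by simp
  also have "\<dots> = (q + (1 - q)) ^ Suc k" by (rule binomial_ring[symmetric])
  finally show ?thesis
    using assms by (subst pos_le_divide_eq) (simp_all add: mult.commute)
qed

text \<open>
  Conditionally on the number \<open>N\<close> of fair coins the probability is at most \<open>1 / sqrt (N + 1)\<close>, and
  \<open>N\<close> is binomial with parameters \<open>card I\<close> and \<open>2 p\<close>.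
\<close>
lemma bernoulli_littlewood_offord:
  fixes x :: "'a \<Rightarrow> real"
  assumes I: "finite I" "\<And>i. i \<in> I \<Longrightarrow> x i \<noteq> 0" and p: "0 < p" "p \<le> 1 / 2"
  shows "measure_pmf.prob (Pi_pmf I False (\<lambda>_. bernoulli_pmf p)) {Y. sum x {i \<in> I. Y i} = a}
     \<le> 1 / sqrt (2 * p * (real (card I) + 1))"
proof -
  let ?P = "Pi_pmf I False (\<lambda>_. bernoulli_pmf p)" and ?k = "card I"
  define q where "q = 2 * p"
  have q: "0 < q" "q \<le> 1" using p by (auto simp: q_def)
  define l where "l = 1 / sqrt (q * (real ?k + 1))"
  have l: "0 < l" "l * l = 1 / (q * (real ?k + 1))" using q by (auto simp: l_def)
  \<comment> \<open>a bound that is linear in \<open>1 / (m + 1)\<close>; the choice of \<open>l\<close> balances its two terms in expectation\<close>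
  have amgm: "1 / sqrt (real m + 1) \<le> (l + (1 / (real m + 1)) / l) / 2" for m :: nat
  proof -
    have "sqrt (l * ((1 / (real m + 1)) / l)) \<le> (l + (1 / (real m + 1)) / l) / 2"
      using l by (intro arith_geo_mean_sqrt) auto
    then show ?thesis using l by (simp add: real_sqrt_divide)
  qed
  let ?w = "\<lambda>m. q ^ m * (1 - q) ^ (?k - m)"
  have "measure_pmf.prob ?P {Y. sum x {i \<in> I. Y i} = a} = measure_pmf.expectation ?P (\<lambda>Y. of_bool (sum x {i \<in> I. Y i} = a))"
  proof -
    have "(\<lambda>Y. of_bool (sum x {i \<in> I. Y i} = a)) = (indicator {Y. sum x {i \<in> I. Y i} = a} :: _ \<Rightarrow> real)"
      by (auto simp: indicator_def fun_eq_iff)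
    then show ?thesis by simp
  qed
  also have "\<dots> = (\<Sum>M\<in>Pow I. q ^ card M * (1 - q) ^ card (I - M) * ((\<Sum>A\<in>Pow M. of_bool (sum x A = a)) / 2 ^ card M))"
    unfolding q_def using I p by (intro bernoulli_set_expectation) auto
  also have "\<dots> \<le> (\<Sum>M\<in>Pow I. ?w (card M) * ((l + (1 / (real (card M) + 1)) / l) / 2))"
  proof (intro sum_mono)
    fix M assume M: "M \<in> Pow I"
    then have finM: "finite M" using I finite_subset by auto
    have "(\<Sum>A\<in>Pow M. of_bool (sum x A = a)) / 2 ^ card M = real (card {A \<in> Pow M. sum x A = a}) / 2 ^ card M"
      using finM by (simp add: of_bool_def sum.If_cases Int_def)
    also have "\<dots> \<le> 1 / sqrt (real (card M) + 1)"
      using M I finM by (intro erdos_littlewood_offord) auto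
    also have "\<dots> \<le> (l + (1 / (real (card M) + 1)) / l) / 2" by (rule amgm)
    finally have "?w (card M) * ((\<Sum>A\<in>Pow M. of_bool (sum x A = a)) / 2 ^ card M)
       \<le> ?w (card M) * ((l + (1 / (real (card M) + 1)) / l) / 2)"
      using q by (intro mult_left_mono) auto
    then show "q ^ card M * (1 - q) ^ card (I - M) * ((\<Sum>A\<in>Pow M. of_bool (sum x A = a)) / 2 ^ card M)
       \<le> ?w (card M) * ((l + (1 / (real (card M) + 1)) / l) / 2)"
      using M finM by (simp only: card_Diff_subset Pow_iff)
  qed
  also have "\<dots> = (\<Sum>m\<le>?k. real (?k choose m) * (?w m * ((l + (1 / (real m + 1)) / l) / 2)))"
    by (rule sum_Pow_card[OF I(1)])
  also have "\<dots> = (\<Sum>m\<le>?k. (l * (real (?k choose m) * q ^ m * (1 - q) ^ (?k - m)) + real (?k choose m) * (?w m / (real m + 1)) / l) / 2)"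
  proof (intro sum.cong refl)
    fix m
    have "u * (v * ((l + (1 / r) / l) / 2)) = (l * (u * v) + u * (v / r) / l) / 2" for u v r :: real
      by (simp add: field_simps)
    from this[of "real (?k choose m)" "?w m" "real m + 1"]
    show "real (?k choose m) * (?w m * ((l + (1 / (real m + 1)) / l) / 2)) =
       (l * (real (?k choose m) * q ^ m * (1 - q) ^ (?k - m)) + real (?k choose m) * (?w m / (real m + 1)) / l) / 2"
      by (simp only: mult.assoc)
  qed
  also have "\<dots> = (l * (\<Sum>m\<le>?k. real (?k choose m) * q ^ m * (1 - q) ^ (?k - m)) +
      (\<Sum>m\<le>?k. real (?k choose m) * (?w m / (real m + 1))) / l) / 2"
    by (simp only: sum_divide_distrib[symmetric] sum.distrib sum_distrib_left[symmetric])
  also have "(\<Sum>m\<le>?k. real (?k choose m) * q ^ m * (1 - q) ^ (?k - m)) = (q + (1 - q)) ^ ?k"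
    by (rule binomial_ring[symmetric])
  also have "(l * (q + (1 - q)) ^ ?k + (\<Sum>m\<le>?k. real (?k choose m) * (?w m / (real m + 1))) / l) / 2
      \<le> (l + (l * l) / l) / 2"
    using binomial_reciprocal_moment[OF q, of ?k] l by (intro divide_right_mono add_mono) auto
  also have "\<dots> = l" using l(1) by simp
  finally show ?thesis by (simp add: l_def q_def)
qed

section \<open>Independent Bernoulli rows\<close>

lemma prob_bind_pmf_le:
  assumes "\<And>x. measure_pmf.prob (f x) E \<le> c"
  shows "measure_pmf.prob (bind_pmf M f) E \<le> c"
proof -
  have c: "0 \<le> c" using assms measure_nonneg order_trans by blast
  have "emeasure (bind_pmf M f) E = (\<integral>\<^sup>+x. emeasure (f x) E \<partial>M)" by simp
  also have "\<dots> \<le> (\<integral>\<^sup>+x. ennreal c \<partial>M)"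
    using assms by (intro nn_integral_mono) (simp add: measure_pmf.emeasure_eq_measure ennreal_leI)
  also have "\<dots> = ennreal c" by simp
  finally show ?thesis using c by (simp add: measure_pmf.emeasure_eq_measure)
qed

text \<open>
  The law of total probability over the coordinates in \<open>A\<close>. It allows a vector that is chosen in terms
  of these coordinates to be treated as fixed.
\<close>
lemma prob_Pi_pmf_conditional_le:
  assumes "finite A" "finite B" "A \<inter> B = {}"
    and "\<And>f. measure_pmf.prob (Pi_pmf B d P) {g. E (\<lambda>i. if i \<in> A then f i else g i)} \<le> c"
  shows "measure_pmf.prob (Pi_pmf (A \<union> B) d P) {X. E X} \<le> c"
proof -
  have "Pi_pmf (A \<union> B) d P = bind_pmf (Pi_pmf A d P) (\<lambda>f. map_pmf (\<lambda>g i. if i \<in> A then f i else g i) (Pi_pmf B d P))"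
    using assms(1-3) by (simp add: Pi_pmf_union pair_pmf_def map_bind_pmf map_pmf_def[symmetric] bind_return_pmf bind_assoc_pmf)
       (simp add: map_pmf_def bind_assoc_pmf bind_return_pmf)
  moreover have "(\<lambda>g i. if i \<in> A then f i else g i) -` {X. E X} = {g. E (\<lambda>i. if i \<in> A then f i else g i)}" for f
    by auto
  ultimately show ?thesis using assms(4) by (auto intro!: prob_bind_pmf_le)
qed

lemma Pi_pmf_curry:
  assumes "finite A" "finite B"
  shows "Pi_pmf (A \<times> B) d (\<lambda>_. P) = map_pmf (\<lambda>X (i, j). X i j) (Pi_pmf A (\<lambda>_. d) (\<lambda>_. Pi_pmf B d (\<lambda>_. P)))"
proof (rule pmf_eqI)
  fix f :: "'a \<times> 'b \<Rightarrow> 'c"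
  let ?X = "\<lambda>i j. f (i, j)"
  have "inj (\<lambda>(X :: 'a \<Rightarrow> 'b \<Rightarrow> 'c) (i, j). X i j)"
    by (auto simp: inj_def fun_eq_iff)
  then have "pmf (map_pmf (\<lambda>X (i, j). X i j) (Pi_pmf A (\<lambda>_. d) (\<lambda>_. Pi_pmf B d (\<lambda>_. P)))) ((\<lambda>(i, j). ?X i j))
     = pmf (Pi_pmf A (\<lambda>_. d) (\<lambda>_. Pi_pmf B d (\<lambda>_. P))) ?X"
    using pmf_map_inj'[of "\<lambda>(X :: 'a \<Rightarrow> 'b \<Rightarrow> 'c) (i, j). X i j"] by blast
  also have "(\<lambda>(i, j). ?X i j) = f" by auto
  also have "pmf (Pi_pmf A (\<lambda>_. d) (\<lambda>_. Pi_pmf B d (\<lambda>_. P))) ?X = pmf (Pi_pmf (A \<times> B) d (\<lambda>_. P)) f"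
  proof (cases "\<forall>x. x \<notin> A \<times> B \<longrightarrow> f x = d")
    case True
    then have "pmf (Pi_pmf A (\<lambda>_. d) (\<lambda>_. Pi_pmf B d (\<lambda>_. P))) ?X = (\<Prod>i\<in>A. \<Prod>j\<in>B. pmf P (f (i, j)))"
      using assms by (simp add: pmf_Pi' fun_eq_iff)
    also have "\<dots> = pmf (Pi_pmf (A \<times> B) d (\<lambda>_. P)) f"
      using assms True by (subst pmf_Pi') (auto simp: prod.cartesian_product)
    finally show ?thesis .
  next
    case False
    then obtain i j where ij: "i \<notin> A \<or> j \<notin> B" "f (i, j) \<noteq> d" by auto
    have "pmf (Pi_pmf A (\<lambda>_. d) (\<lambda>_. Pi_pmf B d (\<lambda>_. P))) ?X = 0"
    proof (cases "i \<in> A")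
      case True
      then have "pmf (Pi_pmf B d (\<lambda>_. P)) (?X i) = 0" using ij assms by (intro pmf_Pi_outside) auto
      then show ?thesis using True by (auto simp: pmf_Pi[OF assms(1)] intro!: prod_zero[OF assms(1)] bexI[of _ i])
    next
      case False
      then show ?thesis using ij assms by (intro pmf_Pi_outside) (auto simp: fun_eq_iff)
    qed
    then show ?thesis using False assms by (simp add: pmf_Pi_outside)
  qed
  finally show "pmf (Pi_pmf (A \<times> B) d (\<lambda>_. P)) f = pmf (map_pmf (\<lambda>X (i, j). X i j) (Pi_pmf A (\<lambda>_. d) (\<lambda>_. Pi_pmf B d (\<lambda>_. P)))) f"
    by simp
qed

definition bernoulli_row :: "nat \<Rightarrow> real \<Rightarrow> (nat \<Rightarrow> bool) pmf" where
  "bernoulli_row n p = Pi_pmf {..<n} False (\<lambda>_. bernoulli_pmf p)"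

definition bernoulli_rows :: "nat \<Rightarrow> real \<Rightarrow> (nat \<Rightarrow> nat \<Rightarrow> bool) pmf" where
  "bernoulli_rows n p = Pi_pmf {..<n} (\<lambda>_. False) (\<lambda>_. bernoulli_row n p)"

lemma bernoulli_mat_rows: "bernoulli_mat n p = map_pmf (bool_mat n) (bernoulli_rows n p)"
  unfolding bernoulli_mat_def bernoulli_rows_def bernoulli_row_def
    Pi_pmf_curry[OF finite_lessThan finite_lessThan] pmf.map_comp
  by (intro map_pmf_cong refl eq_matI) auto

lemma bernoulli_rows_transpose:
  "map_pmf (\<lambda>X i j. X j i) (bernoulli_rows n p) = bernoulli_rows n p"
proof -
  define G where "G = Pi_pmf ({..<n} \<times> {..<n}) False (\<lambda>_. bernoulli_pmf p)"
  have rows: "bernoulli_rows n p = map_pmf (\<lambda>f i j. f (i, j)) G"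
    unfolding G_def bernoulli_rows_def bernoulli_row_def by (simp add: Pi_pmf_curry pmf.map_comp o_def)
  have "G = map_pmf (\<lambda>f. f \<circ> prod.swap) G"
    unfolding G_def by (rule Pi_pmf_bij_betw) (auto simp: bij_betw_def inj_on_def image_iff)
  then have "map_pmf (\<lambda>f i j. f (i, j)) G = map_pmf (\<lambda>f i j. f (i, j)) (map_pmf (\<lambda>f. f \<circ> prod.swap) G)"
    by simp
  then show ?thesis unfolding rows by (simp add: pmf.map_comp o_def)
qed

lemma prob_rows_transpose:
  "measure_pmf.prob (bernoulli_rows n p) {X. P (\<lambda>i j. X j i)} = measure_pmf.prob (bernoulli_rows n p) {X. P X}"
proof -
  have "measure_pmf.prob (bernoulli_rows n p) {X. P X} = measure_pmf.prob (map_pmf (\<lambda>X i j. X j i) (bernoulli_rows n p)) {X. P X}"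
    unfolding bernoulli_rows_transpose ..
  then show ?thesis by (simp add: vimage_def)
qed

lemma prob_rows_independent:
  assumes "finite R"
  shows "measure_pmf.prob (Pi_pmf R d (\<lambda>_. M)) {X. \<forall>i\<in>R. Q i (X i)} = (\<Prod>i\<in>R. measure_pmf.prob M {y. Q i y})"
proof -
  have "{X. \<forall>i\<in>R. Q i (X i)} = Pi R (\<lambda>i. {y. Q i y})" by auto
  then show ?thesis by (simp only: measure_Pi_pmf_Pi[OF assms])
qed

lemma prob_bernoulli_row_restrict:
  assumes "S \<subseteq> {..<n}"
  shows "measure_pmf.prob (bernoulli_row n p) {y. Q {j \<in> S. y j}} =
    measure_pmf.prob (Pi_pmf S False (\<lambda>_. bernoulli_pmf p)) {y. Q {j \<in> S. y j}}"
proof -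
  have "{j \<in> S. if j \<in> S then y j else False} = {j \<in> S. y j}" for y by auto
  then show ?thesis
    unfolding bernoulli_row_def Pi_pmf_subset[OF finite_lessThan assms] by (simp add: vimage_def)
qed

lemma prob_row_orthogonal_le:
  fixes x :: "nat \<Rightarrow> real"
  assumes "S \<subseteq> {..<n}" "\<And>j. j \<in> S \<Longrightarrow> x j \<noteq> 0" "0 < p" "p \<le> 1 / 2"
  shows "measure_pmf.prob (bernoulli_row n p) {y. sum x {j \<in> S. y j} = 0} \<le> 1 / sqrt (2 * p * (real (card S) + 1))"
  unfolding prob_bernoulli_row_restrict[OF assms(1), of p "\<lambda>A. sum x A = 0"]
  by (intro bernoulli_littlewood_offord finite_subset[OF assms(1)] assms finite_lessThan)

lemma prob_row_card_ge:
  assumes "S \<subseteq> {..<n}" "0 < p" "p \<le> 1 / 2"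
  shows "measure_pmf.prob (bernoulli_row n p) {y. card {j \<in> S. y j} \<ge> t} \<le> (real (card S) * p) ^ t"
proof -
  have finS: "finite S" using assms finite_subset by auto
  let ?P = "Pi_pmf S False (\<lambda>_. bernoulli_pmf p)"
  have "measure_pmf.prob ?P {y. card {j \<in> S. y j} \<ge> t} \<le> measure_pmf.prob ?P (\<Union>T\<in>{T. T \<subseteq> S \<and> card T = t}. {y. \<forall>j\<in>S. j \<in> T \<longrightarrow> y j})"
  proof (rule measure_pmf.finite_measure_mono)
    show "{y. card {j \<in> S. y j} \<ge> t} \<subseteq> (\<Union>T\<in>{T. T \<subseteq> S \<and> card T = t}. {y. \<forall>j\<in>S. j \<in> T \<longrightarrow> y j})"
    proof
      fix y assume "y \<in> {y. card {j \<in> S. y j} \<ge> t}"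
      then obtain T where "T \<subseteq> {j \<in> S. y j}" "card T = t"
        using obtain_subset_with_card_n by (metis mem_Collect_eq)
      then show "y \<in> (\<Union>T\<in>{T. T \<subseteq> S \<and> card T = t}. {y. \<forall>j\<in>S. j \<in> T \<longrightarrow> y j})" by blast
    qed
  qed simp
  also have "\<dots> \<le> (\<Sum>T\<in>{T. T \<subseteq> S \<and> card T = t}. measure_pmf.prob ?P {y. \<forall>j\<in>S. j \<in> T \<longrightarrow> y j})"
    using finS by (intro measure_pmf.finite_measure_subadditive_finite) auto
  also have "\<dots> = (\<Sum>T\<in>{T. T \<subseteq> S \<and> card T = t}. p ^ t)"
  proof (intro sum.cong refl)
    fix T assume T: "T \<in> {T. T \<subseteq> S \<and> card T = t}"
    have "measure_pmf.prob ?P {y. \<forall>j\<in>S. j \<in> T \<longrightarrow> y j} = (\<Prod>j\<in>S. measure_pmf.prob (bernoulli_pmf p) {b. j \<in> T \<longrightarrow> b})"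
      by (rule prob_rows_independent[OF finS])
    also have "\<dots> = (\<Prod>j\<in>S. if j \<in> T then p else 1)"
    proof (intro prod.cong refl)
      fix j
      have "{b. b} = {True}" by auto
      then show "measure_pmf.prob (bernoulli_pmf p) {b. j \<in> T \<longrightarrow> b} = (if j \<in> T then p else 1)"
        using assms by (simp add: measure_pmf_single)
    qed
    also have "\<dots> = p ^ t" using T finS by (simp add: prod.If_cases Int_absorb1)
    finally show "measure_pmf.prob ?P {y. \<forall>j\<in>S. j \<in> T \<longrightarrow> y j} = p ^ t" .
  qed
  also have "\<dots> = real (card S choose t) * p ^ t" using n_subsets[OF finS] by simp
  also have "\<dots> \<le> real (card S ^ t) * p ^ t"
  proof (intro mult_right_mono)
    show "real (card S choose t) \<le> real (card S ^ t)"
      unfolding of_nat_le_iff by (cases "t \<le> card S") (simp_all add: binomial_le_pow binomial_eq_0)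
  qed (use assms in simp)
  finally show ?thesis
    unfolding prob_bernoulli_row_restrict[OF assms(1), of p "\<lambda>A. card A \<ge> t"] by (simp add: power_mult_distrib)
qed

lemma prob_row_card_ne_1:
  assumes "S \<subseteq> {..<n}" "0 < p" "p \<le> 1 / 2"
  shows "measure_pmf.prob (bernoulli_row n p) {y. card {j \<in> S. y j} \<noteq> 1} \<le> exp (- (real (card S) * p * (1 - p) ^ card S))"
proof -
  have finS: "finite S" using assms finite_subset by auto
  let ?k = "card S"
  let ?P = "Pi_pmf S False (\<lambda>_. bernoulli_pmf p)"
  have "measure_pmf.prob (bernoulli_row n p) {y. card {j \<in> S. y j} \<noteq> 1} = measure_pmf.prob (map_pmf (\<lambda>y. card {j \<in> S. y j}) ?P) {m. m \<noteq> 1}"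
    unfolding prob_bernoulli_row_restrict[OF assms(1), of p "\<lambda>A. card A \<noteq> 1"] by (simp add: vimage_def)
  also have "map_pmf (\<lambda>y. card {j \<in> S. y j}) ?P = binomial_pmf ?k p"
    using assms finS by (intro binomial_pmf_altdef'[symmetric]) auto
  also have "{m. m \<noteq> 1} = space (measure_pmf (binomial_pmf ?k p)) - {1}" by auto
  also have "measure_pmf.prob (binomial_pmf ?k p) \<dots> = 1 - pmf (binomial_pmf ?k p) 1"
    by (subst measure_pmf.prob_compl) (simp_all add: measure_pmf_single)
  also have "pmf (binomial_pmf ?k p) 1 = real ?k * p * (1 - p) ^ (?k - 1)"
    using assms by simp
  also have "1 - real ?k * p * (1 - p) ^ (?k - 1) \<le> 1 - real ?k * p * (1 - p) ^ ?k"
    using assms by (intro diff_left_mono mult_left_mono power_decreasing) auto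
  also have "\<dots> \<le> exp (- (real ?k * p * (1 - p) ^ ?k))"
    using exp_ge_add_one_self[of "- (real ?k * p * (1 - p) ^ ?k)"] by simp
  finally show ?thesis .
qed

section \<open>Dependencies of few columns\<close>

lemma prob_exists_sum_le:
  assumes "finite A"
  shows "measure_pmf.prob M {X. \<exists>a\<in>A. Q a X} \<le> (\<Sum>a\<in>A. measure_pmf.prob M {X. Q a X})"
proof -
  have "{X. \<exists>a\<in>A. Q a X} = (\<Union>a\<in>A. {X. Q a X})" by auto
  then show ?thesis
    using assms by (simp only:) (intro measure_pmf.finite_measure_subadditive_finite, auto)
qed

lemma prob_exists_le:
  assumes "finite A" "\<And>a. a \<in> A \<Longrightarrow> measure_pmf.prob M {X. Q a X} \<le> c"
  shows "measure_pmf.prob M {X. \<exists>a\<in>A. Q a X} \<le> real (card A) * c"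
proof -
  have "measure_pmf.prob M {X. \<exists>a\<in>A. Q a X} \<le> (\<Sum>a\<in>A. measure_pmf.prob M {X. Q a X})"
    by (rule prob_exists_sum_le[OF assms(1)])
  also have "\<dots> \<le> (\<Sum>a\<in>A. c)" by (intro sum_mono assms)
  finally show ?thesis by simp
qed

lemma prob_mono: "(\<And>X. P X \<Longrightarrow> Q X) \<Longrightarrow> measure_pmf.prob M {X. P X} \<le> measure_pmf.prob M {X. Q X}"
  by (intro measure_pmf.finite_measure_mono) auto

lemma prob_disj_le: "measure_pmf.prob M {X. P X \<or> Q X} \<le> measure_pmf.prob M {X. P X} + measure_pmf.prob M {X. Q X}"
  unfolding Collect_disj_eq by (rule measure_Un_le) auto

text \<open>
  Each non-zero row has at least two ones, and there are at least \<open>card S - 1\<close> such rows. Outside of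
  the graphic case there is thus one surplus: another non-zero row, or a third one in some row.
\<close>
lemma non_graphic_circuit_ones:
  assumes circ: "is_circuit (bmat X) I S x" and fin: "finite I" "finite S" and ng: "\<not> graphic X I S"
  shows "(\<exists>N\<subseteq>I. card N = card S \<and> (\<forall>i\<in>N. card (ones X S i) \<ge> 2)) \<or>
         (\<exists>N\<subseteq>I. card N + 1 = card S \<and> (\<exists>i0\<in>N. \<forall>i\<in>N. card (ones X S i) \<ge> (if i = i0 then 3 else 2)))"
proof -
  define N where "N = {i \<in> I. ones X S i \<noteq> {}}"
  have N: "N \<subseteq> I" "finite N" using fin by (auto simp: N_def)
  have two: "card (ones X S i) \<ge> 2" if "i \<in> N" for i
  proof -
    have "finite (ones X S i)" using fin(2) by (simp add: ones_def)
    then have "card (ones X S i) \<noteq> 0" using that by (simp add: N_def)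
    moreover have "card (ones X S i) \<noteq> 1" using circuit_card_ones_ne_1[OF circ fin(2)] that N by blast
    ultimately show ?thesis by simp
  qed
  have "in_kernel (bmat X) I S y" if "in_kernel (bmat X) N S y" for y
    using that unfolding in_kernel_bmat[OF fin(2)] N_def by force
  then have "card S \<le> card N + 1" using card_determining_rows_ge[OF circ N(2) fin(2)] by blast
  then consider "card S \<le> card N" | "card N + 1 = card S" by linarith
  then show ?thesis
  proof cases
    case 1
    then obtain N' where "N' \<subseteq> N" "card N' = card S" by (meson obtain_subset_with_card_n)
    then show ?thesis using two N(1) by blast
  next
    case 2
    then obtain i0 where i0: "i0 \<in> I" "ones X S i0 \<noteq> {}" "card (ones X S i0) \<noteq> 2"
      using ng by (auto simp: graphic_def N_def)
    then have "i0 \<in> N" "card (ones X S i0) \<ge> 3" using two[of i0] by (auto simp: N_def)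
    then have "\<forall>i\<in>N. card (ones X S i) \<ge> (if i = i0 then 3 else 2)" using two by auto
    then show ?thesis using 2 N(1) \<open>i0 \<in> N\<close> by blast
  qed
qed

lemma prob_ones_pattern_le:
  assumes S: "S \<subseteq> {..<n}" and p: "0 < p" "p \<le> 1 / 2" and N: "N \<subseteq> {..<n}"
  shows "measure_pmf.prob (bernoulli_rows n p)
      {X. \<forall>i\<in>{..<n}. (i \<in> N \<longrightarrow> card (ones X S i) \<ge> r i) \<and> (i \<notin> N \<longrightarrow> card (ones X S i) \<noteq> 1)}
    \<le> (real (card S) * p) ^ (\<Sum>i\<in>N. r i) * exp (- (real (card S) * p * (1 - p) ^ card S)) ^ (n - card N)"
proof -
  let ?k = "card S"
  let ?Q = "\<lambda>i y. (i \<in> N \<longrightarrow> card {j \<in> S. y j} \<ge> r i) \<and> (i \<notin> N \<longrightarrow> card {j \<in> S. y j} \<noteq> 1)"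
  let ?E = "exp (- (real ?k * p * (1 - p) ^ ?k))"
  have finN: "finite N" using N finite_subset by blast
  have "measure_pmf.prob (bernoulli_rows n p) {X. \<forall>i\<in>{..<n}. ?Q i (X i)} = (\<Prod>i\<in>{..<n}. measure_pmf.prob (bernoulli_row n p) {y. ?Q i y})"
    unfolding bernoulli_rows_def by (rule prob_rows_independent) simp
  also have "\<dots> \<le> (\<Prod>i\<in>{..<n}. if i \<in> N then (real ?k * p) ^ r i else ?E)"
    using prob_row_card_ge[OF S p] prob_row_card_ne_1[OF S p] by (intro prod_mono) auto
  also have "\<dots> = (\<Prod>i\<in>N. (real ?k * p) ^ r i) * (\<Prod>i\<in>{..<n}-N. ?E)"
    using N by (simp add: prod.If_cases Int_absorb1 Diff_eq)
  also have "\<dots> = (real ?k * p) ^ (\<Sum>i\<in>N. r i) * ?E ^ (n - card N)"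
    using N finN by (simp add: power_sum card_Diff_subset)
  finally show ?thesis by (simp add: ones_def)
qed

lemma choose_pred_le:
  assumes "1 \<le> k" "2 * k \<le> n"
  shows "real (n choose (k - 1)) \<le> real (n choose k) * (2 * real k / real n)"
proof -
  obtain j where j: "k = Suc j" using assms by (cases k) auto
  have "Suc j * (n choose Suc j) = (n - j) * (n choose j)"
    by (simp only: binomial_absorption binomial_absorb_comp)
  then have "real (Suc j * (n choose Suc j)) = real ((n - j) * (n choose j))" by (rule arg_cong)
  then have "real k * real (n choose k) = (real n - real j) * real (n choose j)"
    using assms j by (simp only: of_nat_mult of_nat_diff)
  moreover have "real n / 2 * real (n choose j) \<le> (real n - real j) * real (n choose j)"
    using assms j by (intro mult_right_mono) auto
  ultimately have "real n / 2 * real (n choose j) \<le> real k * real (n choose k)" by simp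
  then show ?thesis using assms j by (simp add: field_simps)
qed

text \<open>
  The bound \<open>(n choose k) \<le> (e n / k)\<^sup>k\<close>, without a division.
\<close>
lemma choose_mult_power_le: "real (n choose k) * real k ^ k \<le> (exp 1 * real n) ^ k"
proof -
  have "real k ^ k / fact k \<le> exp (real k)"
  proof -
    have "(\<Sum>m\<in>{k}. real k ^ m /\<^sub>R fact m) \<le> (\<Sum>m. real k ^ m /\<^sub>R fact m)"
      by (intro sum_le_suminf summable_exp_generic) auto
    then show ?thesis by (simp add: exp_def field_simps)
  qed
  then have "real k ^ k \<le> fact k * exp (real k)" by (simp add: field_simps)
  then have "real (n choose k) * real k ^ k \<le> real (n choose k) * (fact k * exp (real k))"
    by (intro mult_left_mono) auto
  also have "\<dots> = real ((n choose k) * fact k) * exp (real k)" by simp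
  also have "\<dots> \<le> real (n ^ k) * exp (real k)"
    by (intro mult_right_mono) (simp_all only: of_nat_le_iff binomial_fact_pow exp_ge_zero)
  also have "\<dots> = (exp 1 * real n) ^ k"
    by (simp add: power_mult_distrib exp_of_nat_mult[symmetric])
  finally show ?thesis .
qed

lemma exp_minus_2_le: "0 \<le> p \<Longrightarrow> p \<le> 1 / 2 \<Longrightarrow> exp (- 2 * p) \<le> 1 - (p :: real)"
proof -
  assume p: "0 \<le> p" "p \<le> 1 / 2"
  have "p * (2 * p) \<le> p * 1" using p by (intro mult_left_mono) auto
  then have "1 \<le> (1 - p) * (1 + 2 * p)" by (simp add: algebra_simps)
  also have "\<dots> \<le> (1 - p) * exp (2 * p)" using p exp_ge_add_one_self[of "2 * p"] by (intro mult_left_mono) auto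
  finally have "1 / exp (2 * p) \<le> 1 - p" by (simp add: field_simps)
  then show ?thesis by (simp add: exp_minus field_simps)
qed

text \<open>
  The ratio of the geometric series that bounds the probability of a non-tree dependency of \<open>k\<close>
  columns with \<open>k p \<le> K\<close>, where \<open>d = n p\<close>. For fixed \<open>K\<close> the exponential factor, which comes from the
  rows having no single one, beats the quadratic one.
\<close>
definition small_rate :: "real \<Rightarrow> real \<Rightarrow> real" where
  "small_rate K d = 3 * (exp 1 * d)\<^sup>2 * exp (- (d * exp (- 2 * K) / 2))"

text \<open>
  A union bound over the columns \<open>S\<close> and the rows \<open>N\<close> from \<open>non_graphic_circuit_ones\<close>.
  Choosing \<open>k\<close> columns and \<open>k\<close> rows with two ones each costs
  \<open>(n choose k)\<^sup>2 (k p)\<^sup>2\<^sup>k \<le> (e n p)\<^sup>2\<^sup>k\<close>. The case of \<open>k - 1\<close> rows, one of them with three ones, has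
  one factor \<open>k p\<close> less but also a smaller number of row sets, and altogether differs by the factor
  \<open>2 k / (n p)\<close>. Without the surplus, for \<open>k - 1\<close> rows with two ones, it would be a factor of the
  order of \<open>n / (k (n p)\<^sup>2)\<close>, which the exponential does not absorb if \<open>n p\<close> grows slowly.
\<close>
lemma prob_non_graphic_circuit_small:
  assumes p: "0 < p" "p \<le> 1 / 2" and k: "1 \<le> k" "2 * k \<le> n" and K: "real k * p \<le> K" and d: "1 \<le> real n * p"
  shows "measure_pmf.prob (bernoulli_rows n p)
      {X. \<exists>S\<in>{S. S \<subseteq> {..<n} \<and> card S = k}. \<exists>x. is_circuit (bmat X) {..<n} S x \<and> \<not> graphic X {..<n} S}
    \<le> small_rate K (real n * p) ^ k"
proof -
  let ?P = "bernoulli_rows n p" and ?d = "real n * p"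
  define E where "E = exp (- (?d * exp (- 2 * K) / 2)) ^ k"
  have E: "exp (- (real k * p * (1 - p) ^ k)) ^ (n - m) \<le> E" if "m \<le> k" for m
  proof -
    have "exp (- 2 * K) \<le> exp (real k * (- 2 * p))" using K by simp
    also have "\<dots> = exp (- 2 * p) ^ k" by (rule exp_of_nat_mult)
    also have "\<dots> \<le> (1 - p) ^ k" using exp_minus_2_le[of p] p by (intro power_mono) auto
    finally have m1: "real k * p * exp (- 2 * K) \<le> real k * p * (1 - p) ^ k" using p by (intro mult_left_mono) auto
    have m2: "real n / 2 \<le> real (n - m)" using k that by linarith
    have "real n / 2 * (real k * p * exp (- 2 * K)) \<le> real (n - m) * (real k * p * (1 - p) ^ k)"
      by (rule mult_mono[OF m2 m1]) (use p in auto)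
    then have "real (n - m) * - (real k * p * (1 - p) ^ k) \<le> real k * - (?d * exp (- 2 * K) / 2)"
      by (simp add: mult_ac)
    then show ?thesis unfolding E_def exp_of_nat_mult[symmetric] by simp
  qed
  have kp: "0 < real k * p" using p k by simp
  let ?C = "real (n choose k)"
  have fixed: "measure_pmf.prob ?P {X. \<exists>x. is_circuit (bmat X) {..<n} S x \<and> \<not> graphic X {..<n} S}
     \<le> ?C * ((real k * p) ^ (2 * k) * E) * (1 + 2 * real k)" if S: "S \<in> {S. S \<subseteq> {..<n} \<and> card S = k}" for S
  proof -
    from S have S: "S \<subseteq> {..<n}" "card S = k" "finite S" by (auto intro: finite_subset)
    define pat where "pat = (\<lambda>(r :: nat \<Rightarrow> nat) N X. \<forall>i\<in>{..<n}. (i \<in> N \<longrightarrow> card (ones X S i) \<ge> r i) \<and> (i \<notin> N \<longrightarrow> card (ones X S i) \<noteq> 1))"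
    define A where "A = {N. N \<subseteq> {..<n} \<and> card N = k}"
    define A' where "A' = {N. N \<subseteq> {..<n} \<and> card N = k - 1}"
    have cardA: "card A = n choose k" "card A' = n choose (k - 1)" and finA: "finite A" "finite A'"
      using n_subsets[of "{..<n}"] by (auto simp: A_def A'_def)
    have "measure_pmf.prob ?P {X. \<exists>x. is_circuit (bmat X) {..<n} S x \<and> \<not> graphic X {..<n} S}
      \<le> measure_pmf.prob ?P {X. (\<exists>N\<in>A. pat (\<lambda>_. 2) N X) \<or> (\<exists>N\<in>A'. \<exists>i0\<in>N. pat (\<lambda>i. if i = i0 then 3 else 2) N X)}"
    proof (rule prob_mono, elim exE conjE)
      fix X x assume circ: "is_circuit (bmat X) {..<n} S x" and ng: "\<not> graphic X {..<n} S"
      have "card (ones X S i) \<noteq> 1" if "i < n" for i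
        using circuit_card_ones_ne_1[OF circ S(3)] that by simp
      then have pat: "pat r N X" if "\<forall>i\<in>N. card (ones X S i) \<ge> r i" for r N
        using that unfolding pat_def by simp
      from non_graphic_circuit_ones[OF circ finite_lessThan S(3) ng]
      show "(\<exists>N\<in>A. pat (\<lambda>_. 2) N X) \<or> (\<exists>N\<in>A'. \<exists>i0\<in>N. pat (\<lambda>i. if i = i0 then 3 else 2) N X)"
      proof (elim disjE exE conjE)
        fix N assume "N \<subseteq> {..<n}" "card N = card S" "\<forall>i\<in>N. 2 \<le> card (ones X S i)"
        then have "N \<in> A" "pat (\<lambda>_. 2) N X" using S(2) pat[of N "\<lambda>_. 2"] by (simp_all add: A_def)
        then show ?thesis by blast
      next
        fix N assume N: "N \<subseteq> {..<n}" "card N + 1 = card S"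
          and "\<exists>i0\<in>N. \<forall>i\<in>N. (if i = i0 then 3 else 2) \<le> card (ones X S i)"
        then obtain i0 where "i0 \<in> N" "pat (\<lambda>i. if i = i0 then 3 else 2) N X"
          using pat[of N "\<lambda>i. if i = i0 then 3 else 2" for i0] by blast
        moreover have "N \<in> A'" using N S(2) by (simp add: A'_def)
        ultimately show ?thesis by blast
      qed
    qed
    also have "\<dots> \<le> measure_pmf.prob ?P {X. \<exists>N\<in>A. pat (\<lambda>_. 2) N X} +
        measure_pmf.prob ?P {X. \<exists>N\<in>A'. \<exists>i0\<in>N. pat (\<lambda>i. if i = i0 then 3 else 2) N X}"
      by (rule prob_disj_le)
    also have "\<dots> \<le> real (card A) * ((real k * p) ^ (2 * k) * E) + real (card A') * (real (k - 1) * ((real k * p) ^ (2 * k - 1) * E))"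
    proof (intro add_mono prob_exists_le finA)
      fix N assume "N \<in> A"
      then have N: "N \<subseteq> {..<n}" "card N = k" by (auto simp: A_def)
      have "measure_pmf.prob ?P {X. pat (\<lambda>_. 2) N X} \<le> (real k * p) ^ (\<Sum>i\<in>N. 2) * exp (- (real k * p * (1 - p) ^ k)) ^ (n - k)"
        using prob_ones_pattern_le[OF S(1) p N(1), of "\<lambda>_. 2"] unfolding pat_def S(2) N(2) .
      also have "\<dots> \<le> (real k * p) ^ (\<Sum>i\<in>N. 2) * E" using kp by (intro mult_left_mono E) auto
      finally show "measure_pmf.prob ?P {X. pat (\<lambda>_. 2) N X} \<le> (real k * p) ^ (2 * k) * E"
        by (simp add: N mult.commute)
    next
      fix N assume "N \<in> A'"
      then have N: "N \<subseteq> {..<n}" "card N = k - 1" "finite N" by (auto simp: A'_def intro: finite_subset)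
      have "measure_pmf.prob ?P {X. pat (\<lambda>i. if i = i0 then 3 else 2) N X} \<le> (real k * p) ^ (2 * k - 1) * E" if i0: "i0 \<in> N" for i0
      proof -
        have "measure_pmf.prob ?P {X. pat (\<lambda>i. if i = i0 then 3 else 2) N X} \<le> (real k * p) ^ (\<Sum>i\<in>N. if i = i0 then 3 else 2) * exp (- (real k * p * (1 - p) ^ k)) ^ (n - (k - 1))"
          using prob_ones_pattern_le[OF S(1) p N(1), of "\<lambda>i. if i = i0 then 3 else 2"] unfolding pat_def S(2) N(2) .
        also have "\<dots> \<le> (real k * p) ^ (\<Sum>i\<in>N. if i = i0 then 3 else 2) * E" using kp by (intro mult_left_mono E) auto
        also have "(\<Sum>i\<in>N. if i = i0 then 3 else 2 :: nat) = 3 + (\<Sum>i\<in>N-{i0}. 2)"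
          using N i0 by (subst sum.remove[of _ i0]) (auto intro!: sum.cong)
        also have "\<dots> = 2 * k - 1"
        proof -
          have "card N > 0" using N(3) i0 by (auto simp: card_gt_0_iff)
          then show ?thesis using N i0 by (simp add: card_Diff_singleton)
        qed
        finally show ?thesis .
      qed
      then have "measure_pmf.prob ?P {X. \<exists>i0\<in>N. pat (\<lambda>i. if i = i0 then 3 else 2) N X} \<le> real (card N) * ((real k * p) ^ (2 * k - 1) * E)"
        by (intro prob_exists_le N)
      then show "measure_pmf.prob ?P {X. \<exists>i0\<in>N. pat (\<lambda>i. if i = i0 then 3 else 2) N X} \<le> real (k - 1) * ((real k * p) ^ (2 * k - 1) * E)"
        by (simp add: N)
    qed
    also have "real (card A') * (real (k - 1) * ((real k * p) ^ (2 * k - 1) * E))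
        \<le> ?C * (2 * real k / real n) * (real k * ((real k * p) ^ (2 * k - 1) * E))"
      unfolding cardA using k kp choose_pred_le[OF k] by (intro mult_mono) (auto simp: E_def)
    also have "\<dots> = ?C * ((real k * p) ^ (2 * k) * E) * (2 * real k / ?d)"
    proof -
      have "2 * k = Suc (2 * k - 1)" using k by simp
      then have "(real k * p) ^ (2 * k) = real k * p * (real k * p) ^ (2 * k - 1)" by (metis power_Suc)
      then show ?thesis using p by (simp add: field_simps)
    qed
    also have "\<dots> \<le> ?C * ((real k * p) ^ (2 * k) * E) * (2 * real k)"
    proof (intro mult_left_mono)
      show "2 * real k / ?d \<le> 2 * real k" using divide_left_mono[of 1 ?d "2 * real k"] d by simp
    qed (use kp in \<open>auto simp: E_def\<close>)
    finally show ?thesis unfolding cardA by (simp add: algebra_simps)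
  qed
  have three: "1 + 2 * real k \<le> 3 ^ k"
    using Bernoulli_inequality[of 2 k] by (simp add: mult.commute)
  have "measure_pmf.prob ?P {X. \<exists>S\<in>{S. S \<subseteq> {..<n} \<and> card S = k}. \<exists>x. is_circuit (bmat X) {..<n} S x \<and> \<not> graphic X {..<n} S}
     \<le> real (card {S. S \<subseteq> {..<n} \<and> card S = k}) * (?C * ((real k * p) ^ (2 * k) * E) * (1 + 2 * real k))"
    by (intro prob_exists_le fixed) auto
  also have "card {S. S \<subseteq> {..<n} \<and> card S = k} = n choose k" using n_subsets[of "{..<n}" k] by simp
  also have "?C * (?C * ((real k * p) ^ (2 * k) * E) * (1 + 2 * real k)) = (?C * real k ^ k)\<^sup>2 * (p ^ k)\<^sup>2 * E * (1 + 2 * real k)"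
    by (simp add: power_mult_distrib power_mult power2_eq_square mult_ac)
  also have "\<dots> \<le> ((exp 1 * real n) ^ k)\<^sup>2 * (p ^ k)\<^sup>2 * E * 3 ^ k"
    using choose_mult_power_le[of n k] three p by (intro mult_mono power_mono) (auto simp: E_def)
  also have "\<dots> = small_rate K ?d ^ k"
  proof -
    have "(a ^ k)\<^sup>2 * (b ^ k)\<^sup>2 * e ^ k * 3 ^ k = (3 * (a * b)\<^sup>2 * e) ^ k" for a b e :: real
      by (simp add: power_mult_distrib power2_eq_square mult_ac)
    then show ?thesis by (simp only: small_rate_def E_def mult.assoc[of "exp 1", symmetric])
  qed
  finally show ?thesis .
qed

section \<open>Dependencies of a moderate number of columns\<close>

lemma is_circuit_rows_cong:
  assumes "\<And>i. i \<in> R \<Longrightarrow> X i = Y i"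
  shows "is_circuit (bmat X) R S x \<longleftrightarrow> is_circuit (bmat Y) R S x"
  using assms unfolding is_circuit_def in_kernel_def by simp

text \<open>
  If the rows in \<open>R\<close> determine the kernel vector up to a factor, then the other rows are independent
  of it, and each of them is orthogonal to it with the probability bounded by the
  Littlewood-Offord estimate.
\<close>
lemma prob_rows_orthogonal_given_rows:
  assumes S: "S \<subseteq> {..<n}" and p: "0 < p" "p \<le> 1 / 2" and R: "R \<subseteq> {..<n}"
  shows "measure_pmf.prob (bernoulli_rows n p)
      {X. \<exists>x. is_circuit (bmat X) R S x \<and> in_kernel (bmat X) {..<n} S x}
    \<le> (1 / sqrt (2 * p * (real (card S) + 1))) ^ (n - card R)"
proof -
  let ?B = "{..<n} - R" and ?\<rho> = "1 / sqrt (2 * p * (real (card S) + 1))"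
  have fin: "finite R" "finite S" using R S finite_subset by blast+
  have n: "{..<n} = R \<union> ?B" using R by auto
  define E where "E = (\<lambda>X. \<exists>x. is_circuit (bmat X) R S x \<and> in_kernel (bmat X) {..<n} S x)"
  have "measure_pmf.prob (Pi_pmf (R \<union> ?B) (\<lambda>_. False) (\<lambda>_. bernoulli_row n p)) {X. E X} \<le> ?\<rho> ^ card ?B"
  proof (rule prob_Pi_pmf_conditional_le)
    fix f :: "nat \<Rightarrow> nat \<Rightarrow> bool"
    let ?m = "\<lambda>g i. if i \<in> R then f i else g i"
    show "measure_pmf.prob (Pi_pmf ?B (\<lambda>_. False) (\<lambda>_. bernoulli_row n p)) {g. E (?m g)} \<le> ?\<rho> ^ card ?B"
    proof (cases "\<exists>x. is_circuit (bmat f) R S x")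
      case False
      have "is_circuit (bmat (?m g)) R S x \<longleftrightarrow> is_circuit (bmat f) R S x" for g x
        by (rule is_circuit_rows_cong) simp
      with False have "{g. E (?m g)} = {}" unfolding E_def by blast
      then show ?thesis using p by simp
    next
      case True
      then obtain z where z: "is_circuit (bmat f) R S z" by blast
      have "measure_pmf.prob (Pi_pmf ?B (\<lambda>_. False) (\<lambda>_. bernoulli_row n p)) {g. E (?m g)}
          \<le> measure_pmf.prob (Pi_pmf ?B (\<lambda>_. False) (\<lambda>_. bernoulli_row n p)) {g. \<forall>i\<in>?B. sum z {j \<in> S. g i j} = 0}"
      proof (rule prob_mono)
        fix g assume "E (?m g)"
        then obtain x where x: "is_circuit (bmat (?m g)) R S x" "in_kernel (bmat (?m g)) {..<n} S x"
          by (auto simp: E_def)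
        have "is_circuit (bmat (?m g)) R S z"
          using z by (subst is_circuit_rows_cong[of R _ f]) auto
        then obtain c where c: "\<forall>j\<in>S. z j = c * x j"
          using x(1) unfolding is_circuit_def by blast
        show "\<forall>i\<in>?B. sum z {j \<in> S. g i j} = 0"
        proof
          fix i assume i: "i \<in> ?B"
          have "sum z {j \<in> S. g i j} = c * sum x {j \<in> S. g i j}"
            unfolding sum_distrib_left using c by (intro sum.cong) auto
          also have "sum x (ones (?m g) S i) = 0"
            using x(2) i unfolding in_kernel_bmat[OF fin(2)] by blast
          then have "sum x {j \<in> S. g i j} = 0" using i by (simp add: ones_def)
          finally show "sum z {j \<in> S. g i j} = 0" by simp
        qed
      qed
      also have "\<dots> = (\<Prod>i\<in>?B. measure_pmf.prob (bernoulli_row n p) {y. sum z {j \<in> S. y j} = 0})"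
        by (rule prob_rows_independent) simp
      also have "\<dots> \<le> (\<Prod>i\<in>?B. ?\<rho>)"
        using z by (intro prod_mono conjI prob_row_orthogonal_le[OF S _ p]) (auto simp: is_circuit_def)
      finally show ?thesis by simp
    qed
  qed (use fin in auto)
  then show ?thesis
    using R fin unfolding n[symmetric] by (simp add: bernoulli_rows_def E_def card_Diff_subset)
qed

text \<open>
  There are at most \<open>4\<^sup>n\<close> choices of \<open>k\<close> columns and \<open>k - 1\<close> determining rows. At least half of the
  rows remain, and for \<open>k p \<ge> 2048\<close> each of them satisfies its equation with probability at most
  \<open>1 / 64 = 1 / sqrt (2 * 2048)\<close>, which contributes a factor of at most \<open>8\<^sup>-\<^sup>n\<close>.
\<close>
lemma prob_circuit_medium:
  assumes p: "0 < p" "p \<le> 1 / 2" and k: "1 \<le> k" "2 * k \<le> n" and K: "2048 \<le> real k * p"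
  shows "measure_pmf.prob (bernoulli_rows n p)
      {X. \<exists>S\<in>{S. S \<subseteq> {..<n} \<and> card S = k}. \<exists>x. is_circuit (bmat X) {..<n} S x} \<le> (1 / 2) ^ n"
proof -
  let ?P = "bernoulli_rows n p" and ?\<rho> = "1 / sqrt (2 * p * (real k + 1))"
  let ?A = "{S. S \<subseteq> {..<n} \<and> card S = k}" and ?A' = "{R. R \<subseteq> {..<n} \<and> card R = k - 1}"
  have card: "card ?A = n choose k" "card ?A' = n choose (k - 1)" "finite ?A" "finite ?A'"
    using n_subsets[of "{..<n}"] by auto
  have "sqrt (64\<^sup>2) \<le> sqrt (2 * p * (real k + 1))" using K p by (intro real_sqrt_le_mono) (simp add: algebra_simps)
  then have \<rho>: "0 \<le> ?\<rho>" "?\<rho> \<le> 1 / 64" using p frac_le[of 1 1 64 "sqrt (2 * p * (real k + 1))"] by auto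
  define m where "m = n - (k - 1)"
  have m: "n \<le> 2 * m" using k by (simp add: m_def)
  have "?\<rho> ^ m \<le> (1 / 64) ^ m" by (rule power_mono[OF \<rho>(2,1)])
  also have "\<dots> = (1 / 8) ^ (2 * m)" by (simp add: power_mult power2_eq_square)
  also have "\<dots> \<le> (1 / 8) ^ n" using m by (intro power_decreasing) auto
  finally have \<rho>m: "?\<rho> ^ m \<le> (1 / 8) ^ n" .
  have fixed: "measure_pmf.prob ?P {X. \<exists>x. is_circuit (bmat X) {..<n} S x} \<le> real (n choose (k - 1)) * (1 / 8) ^ n"
    if "S \<in> ?A" for S
  proof -
    from that have S: "S \<subseteq> {..<n}" "card S = k" "finite S" "S \<noteq> {}" using k by (auto intro: finite_subset)
    have "measure_pmf.prob ?P {X. \<exists>x. is_circuit (bmat X) {..<n} S x}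
       \<le> measure_pmf.prob ?P {X. \<exists>R\<in>?A'. \<exists>x. is_circuit (bmat X) R S x \<and> in_kernel (bmat X) {..<n} S x}"
    proof (rule prob_mono, elim exE)
      fix X x assume circ: "is_circuit (bmat X) {..<n} S x"
      then obtain R where R: "R \<subseteq> {..<n}" "card R + 1 \<le> card S" "is_circuit (bmat X) R S x"
        using circuit_determining_rows[OF circ _ S(3,4)] by auto
      have "\<exists>R'. R \<subseteq> R' \<and> R' \<subseteq> {..<n} \<and> card R' = k - 1"
        using R S(2) k by (intro exists_subset_between) auto
      then obtain R' where R': "R \<subseteq> R'" "R' \<subseteq> {..<n}" "card R' = k - 1" by blast
      have "in_kernel (bmat X) {..<n} S x" using circ by (simp add: is_circuit_def)
      moreover from this have "in_kernel (bmat X) R' S x" using R'(2) by (auto simp: in_kernel_def)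
      ultimately show "\<exists>R\<in>?A'. \<exists>x. is_circuit (bmat X) R S x \<and> in_kernel (bmat X) {..<n} S x"
        using is_circuit_superset[OF R(3) R'(1)] R' by blast
    qed
    also have "\<dots> \<le> real (card ?A') * (1 / 8) ^ n"
    proof (rule prob_exists_le[OF card(4)])
      fix R assume "R \<in> ?A'"
      then have R: "R \<subseteq> {..<n}" "card R = k - 1" by auto
      show "measure_pmf.prob ?P {X. \<exists>x. is_circuit (bmat X) R S x \<and> in_kernel (bmat X) {..<n} S x} \<le> (1 / 8) ^ n"
        using prob_rows_orthogonal_given_rows[OF S(1) p R(1)] \<rho>m unfolding S(2) R(2) m_def by linarith
    qed
    finally show ?thesis by (simp only: card)
  qed
  have "measure_pmf.prob ?P {X. \<exists>S\<in>?A. \<exists>x. is_circuit (bmat X) {..<n} S x} \<le> real (card ?A) * (real (n choose (k - 1)) * (1 / 8) ^ n)"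
    by (rule prob_exists_le[OF card(3) fixed])
  also have "\<dots> \<le> 2 ^ n * (2 ^ n * (1 / 8) ^ n)"
  proof -
    have "real (n choose j) \<le> 2 ^ n" for j
      using binomial_le_pow2[of n j] by (metis of_nat_le_iff of_nat_numeral of_nat_power)
    then show ?thesis unfolding card by (intro mult_mono) auto
  qed
  also have "\<dots> = (1 / 2) ^ n" by (simp add: power_mult_distrib[symmetric])
  finally show ?thesis .
qed

section \<open>Dependencies of more than half of the columns\<close>

lemma prob_average_le:
  assumes "finite I" and "\<And>X. E X \<Longrightarrow> c \<le> real (card {i \<in> I. F i X})"
  shows "c * measure_pmf.prob M {X. E X} \<le> (\<Sum>i\<in>I. measure_pmf.prob M {X. F i X})"
proof -
  have int: "integrable (measure_pmf M) (indicator A :: _ \<Rightarrow> real)" for A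
    by (rule integrable_real_indicator) (auto simp: less_top[symmetric])
  have "c * measure_pmf.prob M {X. E X} = measure_pmf.expectation M (\<lambda>X. c * indicator {X. E X} X)"
    by simp
  also have "\<dots> \<le> measure_pmf.expectation M (\<lambda>X. \<Sum>i\<in>I. indicator {X. F i X} X)"
  proof (rule integral_mono)
    fix X
    have "(\<Sum>i\<in>I. indicator {X. F i X} X) = real (card {i \<in> I. F i X})"
      using assms(1) by (simp add: indicator_def sum.If_cases Int_def)
    then show "c * indicator {X. E X} X \<le> (\<Sum>i\<in>I. indicator {X. F i X} X)"
      using assms(2)[of X] by (cases "E X") auto
  qed (auto intro!: int Bochner_Integration.integrable_sum)
  also have "\<dots> = (\<Sum>i\<in>I. measure_pmf.prob M {X. F i X})"
    using int by (subst Bochner_Integration.integral_sum) auto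
  finally show ?thesis .
qed

text \<open>
  The threshold of one half matters twice: a row picked at random is more likely than not in the support of
  a kernel vector of the transpose, and the support is long enough for the Littlewood-Offord bound.
\<close>
definition large_kernel :: "nat \<Rightarrow> (nat \<Rightarrow> nat \<Rightarrow> bool) \<Rightarrow> bool" where
  "large_kernel n X \<longleftrightarrow> (\<exists>S x. S \<subseteq> {..<n} \<and> n < 2 * card S \<and> (\<forall>j\<in>S. x j \<noteq> 0) \<and> in_kernel (bmat X) {..<n} S x)"

text \<open>
  If row \<open>i\<close> is a linear combination of the other rows in \<open>T\<close>, then it is orthogonal to every vector
  that these are orthogonal to.
\<close>
lemma dependent_row_orthogonal:
  assumes fin: "finite S" "finite T" and i: "i \<in> T" "y i \<noteq> 0"
    and y: "in_kernel (bmat (\<lambda>j i. X i j)) S T y"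
    and x: "in_kernel (bmat X) (T - {i}) S x"
  shows "sum x (ones X S i) = 0"
proof -
  have row: "(\<Sum>j\<in>S. bmat X i' j * x j) = sum x (ones X S i')" for i'
    using in_kernel_bmat[OF fin(1)] fin(1) by (simp add: ones_def of_bool_def if_distrib[of "\<lambda>u. u * _"] sum.If_cases Int_def cong: if_cong)
  have "0 = (\<Sum>j\<in>S. x j * (\<Sum>i'\<in>T. bmat X i' j * y i'))"
    using y by (simp add: in_kernel_def)
  also have "\<dots> = (\<Sum>i'\<in>T. y i' * (\<Sum>j\<in>S. bmat X i' j * x j))"
    unfolding sum_distrib_left by (subst sum.swap) (simp add: mult_ac)
  also have "\<dots> = y i * (\<Sum>j\<in>S. bmat X i j * x j)"
    using x fin(2) i(1) by (simp add: in_kernel_def sum.remove[of T i])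
  finally show ?thesis using i(2) row by simp
qed

text \<open>
  The rows other than \<open>i\<close> already have a kernel vector \<open>x\<close> of large support, which can be chosen as a
  function of these rows. If row \<open>i\<close> depends on them, then it is orthogonal to \<open>x\<close>, although it is
  independent of \<open>x\<close>.
\<close>
lemma prob_large_kernel_dependent_row:
  assumes p: "0 < p" "p \<le> 1 / 2" and i: "i < n"
  shows "measure_pmf.prob (bernoulli_rows n p)
     {X. large_kernel n X \<and> (\<exists>T\<subseteq>{..<n}. i \<in> T \<and> (\<exists>y. y i \<noteq> 0 \<and> in_kernel (bmat (\<lambda>j i. X i j)) {..<n} T y))}
    \<le> 1 / sqrt (real n * p)"
proof -
  define E where "E = (\<lambda>X. large_kernel n X \<and> (\<exists>T\<subseteq>{..<n}. i \<in> T \<and> (\<exists>y. y i \<noteq> 0 \<and> in_kernel (bmat (\<lambda>j i. X i j)) {..<n} T y)))"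
  let ?A = "{..<n} - {i}"
  have n: "{..<n} = ?A \<union> {i}" using i by auto
  have "measure_pmf.prob (Pi_pmf (?A \<union> {i}) (\<lambda>_. False) (\<lambda>_. bernoulli_row n p)) {X. E X} \<le> 1 / sqrt (real n * p)"
  proof (rule prob_Pi_pmf_conditional_le)
    fix f :: "nat \<Rightarrow> nat \<Rightarrow> bool"
    let ?m = "\<lambda>g i'. if i' \<in> ?A then f i' else g i'"
    let ?M = "Pi_pmf {i} (\<lambda>_. False) (\<lambda>_. bernoulli_row n p)"
    define L where "L = (\<lambda>S x. S \<subseteq> {..<n} \<and> n < 2 * card S \<and> (\<forall>j\<in>S. x j \<noteq> (0 :: real)) \<and> in_kernel (bmat f) ?A S x)"
    have m: "in_kernel (bmat (?m g)) ?A S x \<longleftrightarrow> in_kernel (bmat f) ?A S x" for g S x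
      by (simp add: in_kernel_def)
    show "measure_pmf.prob ?M {g. E (?m g)} \<le> 1 / sqrt (real n * p)"
    proof (cases "\<exists>S x. L S x")
      case False
      have "\<not> large_kernel n (?m g)" for g
      proof
        assume "large_kernel n (?m g)"
        then obtain S x where S: "S \<subseteq> {..<n}" "n < 2 * card S" "\<forall>j\<in>S. x j \<noteq> 0" "in_kernel (bmat (?m g)) {..<n} S x"
          unfolding large_kernel_def by blast
        then have "in_kernel (bmat (?m g)) ?A S x" unfolding in_kernel_def by blast
        then have "in_kernel (bmat f) ?A S x" using m by blast
        with S False show False unfolding L_def by blast
      qed
      then have "{g. E (?m g)} = {}" unfolding E_def by blast
      then show ?thesis using p by simp
    next
      case True
      then obtain S x where L: "L S x" by blast
      then have S: "S \<subseteq> {..<n}" "n < 2 * card S" "\<And>j. j \<in> S \<Longrightarrow> x j \<noteq> 0" "in_kernel (bmat f) ?A S x" "finite S"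
        by (auto simp: L_def intro: finite_subset)
      have "measure_pmf.prob ?M {g. E (?m g)} \<le> measure_pmf.prob ?M {g. \<forall>i'\<in>{i}. sum x {j \<in> S. g i' j} = 0}"
      proof (rule prob_mono)
        fix g assume "E (?m g)"
        then obtain T y where T: "T \<subseteq> {..<n}" "i \<in> T" "y i \<noteq> 0" "in_kernel (bmat (\<lambda>j i. ?m g i j)) {..<n} T y"
          unfolding E_def by blast
        have "in_kernel (bmat (\<lambda>j i. ?m g i j)) S T y" using T(4) S(1) by (auto simp: in_kernel_def)
        moreover have "in_kernel (bmat (?m g)) (T - {i}) S x"
          using S(4) T(1) m[of g S x] unfolding in_kernel_def by blast
        ultimately have "sum x (ones (?m g) S i) = 0"
          using dependent_row_orthogonal[of S T i y "?m g" x] S(5) T finite_subset[OF T(1)] by simp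
        then show "\<forall>i'\<in>{i}. sum x {j \<in> S. g i' j} = 0" by (simp add: ones_def)
      qed
      also have "\<dots> = measure_pmf.prob (bernoulli_row n p) {y. sum x {j \<in> S. y j} = 0}"
        by (subst prob_rows_independent) auto
      also have "\<dots> \<le> 1 / sqrt (2 * p * (real (card S) + 1))"
        by (rule prob_row_orthogonal_le[OF S(1,3) p])
      also have "\<dots> \<le> 1 / sqrt (real n * p)"
      proof (intro divide_left_mono real_sqrt_le_mono mult_pos_pos)
        have "real n * p \<le> (2 * (real (card S) + 1)) * p" using S(2) p by (intro mult_right_mono) auto
        also have "\<dots> = 2 * p * (real (card S) + 1)" by (simp add: algebra_simps)
        finally show "real n * p \<le> 2 * p * (real (card S) + 1)" .
      qed (use p i in auto)
      finally show ?thesis .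
    qed
  qed auto
  then show ?thesis unfolding n[symmetric] by (simp add: bernoulli_rows_def E_def)
qed

text \<open>
  A kernel vector of the transposed matrix with large support makes more than half of the rows
  depend on the others. So up to a factor of two the event is as likely as the one of the preceding
  lemma for an average row.
\<close>
lemma prob_two_large_kernels:
  assumes p: "0 < p" "p \<le> 1 / 2" and n: "0 < n"
  shows "measure_pmf.prob (bernoulli_rows n p) {X. large_kernel n X \<and> large_kernel n (\<lambda>i j. X j i)} \<le> 2 / sqrt (real n * p)"
proof -
  let ?F = "\<lambda>i X. large_kernel n X \<and> (\<exists>T\<subseteq>{..<n}. i \<in> T \<and> (\<exists>y. y i \<noteq> 0 \<and> in_kernel (bmat (\<lambda>j i. X i j)) {..<n} T y))"
  have "real n / 2 * measure_pmf.prob (bernoulli_rows n p) {X. large_kernel n X \<and> large_kernel n (\<lambda>i j. X j i)}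
      \<le> (\<Sum>i\<in>{..<n}. measure_pmf.prob (bernoulli_rows n p) {X. ?F i X})"
  proof (rule prob_average_le)
    fix X assume X: "large_kernel n X \<and> large_kernel n (\<lambda>i j. X j i)"
    then obtain T y where T: "T \<subseteq> {..<n}" "n < 2 * card T" "\<forall>i\<in>T. y i \<noteq> 0" "in_kernel (bmat (\<lambda>i j. X j i)) {..<n} T y"
      unfolding large_kernel_def by blast
    have "T \<subseteq> {i \<in> {..<n}. ?F i X}" using X T by blast
    then have "card T \<le> card {i \<in> {..<n}. ?F i X}" by (intro card_mono) auto
    with T(2) show "real n / 2 \<le> real (card {i \<in> {..<n}. ?F i X})" by linarith
  qed simp
  also have "\<dots> \<le> (\<Sum>i\<in>{..<n}. 1 / sqrt (real n * p))"
    by (intro sum_mono prob_large_kernel_dependent_row[OF p]) simp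
  also have "\<dots> = real n / 2 * (2 / sqrt (real n * p))" by simp
  finally show ?thesis by (rule mult_left_le_imp_le) (use n in simp)
qed

section \<open>The theorem\<close>

definition short_non_graphic :: "nat \<Rightarrow> (nat \<Rightarrow> nat \<Rightarrow> bool) \<Rightarrow> bool" where
  "short_non_graphic n X \<longleftrightarrow> (\<exists>S x. S \<subseteq> {..<n} \<and> S \<noteq> {} \<and> 2 * card S \<le> n \<and> is_circuit (bmat X) {..<n} S x \<and> \<not> graphic X {..<n} S)"

text \<open>
  Each size \<open>k \<le> n / 2\<close> is covered by one of the two union bounds, according to whether \<open>k p\<close> exceeds
  \<open>2048\<close>. The index \<open>k\<close> in the proof is the size minus one.
\<close>
lemma prob_short_non_graphic:
  assumes p: "0 < p" "p \<le> 1 / 2" and d: "1 \<le> real n * p" and \<eta>: "small_rate 2048 (real n * p) \<le> 1 / 2"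
  shows "measure_pmf.prob (bernoulli_rows n p) {X. short_non_graphic n X}
    \<le> 2 * small_rate 2048 (real n * p) + real n * (1 / 2) ^ n"
proof -
  let ?P = "bernoulli_rows n p" and ?\<eta> = "small_rate 2048 (real n * p)"
  define Q where "Q = (\<lambda>k X. 2 * Suc k \<le> n \<and> (\<exists>S\<in>{S. S \<subseteq> {..<n} \<and> card S = Suc k}. \<exists>x. is_circuit (bmat X) {..<n} S x \<and> \<not> graphic X {..<n} S))"
  have \<eta>0: "0 \<le> ?\<eta>" by (simp add: small_rate_def)
  have "measure_pmf.prob ?P {X. short_non_graphic n X} \<le> measure_pmf.prob ?P {X. \<exists>k\<in>{..<n}. Q k X}"
  proof (rule prob_mono)
    fix X assume "short_non_graphic n X"
    then obtain S x where S: "S \<subseteq> {..<n}" "S \<noteq> {}" "2 * card S \<le> n" "is_circuit (bmat X) {..<n} S x" "\<not> graphic X {..<n} S"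
      unfolding short_non_graphic_def by blast
    then have "card S \<noteq> 0" by (metis card_0_eq finite_lessThan finite_subset)
    then obtain k where "card S = Suc k" using not0_implies_Suc by blast
    with S show "\<exists>k\<in>{..<n}. Q k X" unfolding Q_def by (intro bexI[of _ k]) auto
  qed
  also have "\<dots> \<le> (\<Sum>k<n. measure_pmf.prob ?P {X. Q k X})" by (rule prob_exists_sum_le) simp
  also have "\<dots> \<le> (\<Sum>k<n. ?\<eta> * (1 / 2) ^ k + (1 / 2) ^ n)"
  proof (rule sum_mono)
    fix k
    show "measure_pmf.prob ?P {X. Q k X} \<le> ?\<eta> * (1 / 2) ^ k + (1 / 2) ^ n"
    proof (cases "2 * Suc k \<le> n")
      case False
      then have "{X. Q k X} = {}" by (simp add: Q_def)
      then show ?thesis using \<eta>0 by simp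
    next
      case k: True
      show ?thesis
      proof (cases "real (Suc k) * p \<le> 2048")
        case True
        have "measure_pmf.prob ?P {X. Q k X} \<le> ?\<eta> ^ Suc k"
          using prob_non_graphic_circuit_small[OF p _ k True d] k by (simp add: Q_def)
        also have "\<dots> \<le> ?\<eta> * (1 / 2) ^ k" using \<eta> \<eta>0 by (simp add: mult_left_mono power_mono)
        finally show ?thesis by (simp add: add_increasing2)
      next
        case False
        have "measure_pmf.prob ?P {X. Q k X} \<le> measure_pmf.prob ?P {X. \<exists>S\<in>{S. S \<subseteq> {..<n} \<and> card S = Suc k}. \<exists>x. is_circuit (bmat X) {..<n} S x}"
          by (rule prob_mono) (auto simp: Q_def)
        also have "\<dots> \<le> (1 / 2) ^ n" using False by (intro prob_circuit_medium p k) auto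
        finally show ?thesis using \<eta>0 by (simp add: add_increasing)
      qed
    qed
  qed
  also have "\<dots> = ?\<eta> * (\<Sum>k<n. (1 / 2) ^ k) + real n * (1 / 2) ^ n"
    by (simp add: sum.distrib sum_distrib_left)
  also have "\<dots> \<le> ?\<eta> * 2 + real n * (1 / 2) ^ n"
    using \<eta>0 by (intro add_right_mono mult_left_mono) (simp_all add: sum_gp_strict)
  finally show ?thesis by (simp only: mult.commute)
qed

lemma not_only_tree_cases:
  assumes "\<not> only_tree_dependencies (bool_mat n X)"
  shows "short_non_graphic n X \<or> large_kernel n X"
proof -
  obtain S x where S: "S \<subseteq> {..<n}" "S \<noteq> {}" "is_circuit (bmat X) {..<n} S x" "\<not> graphic X {..<n} S"
    using non_tree_dependency_circuit[OF assms] by blast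
  show ?thesis
  proof (cases "2 * card S \<le> n")
    case True
    then show ?thesis using S unfolding short_non_graphic_def by blast
  next
    case False
    then have "n < 2 * card S" by simp
    moreover have "\<forall>j\<in>S. x j \<noteq> 0" "in_kernel (bmat X) {..<n} S x" using S(3) by (auto simp: is_circuit_def)
    ultimately show ?thesis using S(1) unfolding large_kernel_def by blast
  qed
qed

text \<open>
  If both the matrix and its transpose fail, then one of them has a non-tree dependency of at most
  half of its columns, or both have a kernel vector of large support. Only the latter case needs
  the two matrices simultaneously.
\<close>
lemma prob_only_tree_dependencies_ge:
  assumes p: "0 < p" "p \<le> 1 / 2" and d: "1 \<le> real n * p" and \<eta>: "small_rate 2048 (real n * p) \<le> 1 / 2"
  shows "1 - (2 * (2 * small_rate 2048 (real n * p) + real n * (1 / 2) ^ n) + 2 / sqrt (real n * p))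
    \<le> measure_pmf.prob (bernoulli_mat n p) {B. only_tree_dependencies B \<or> only_tree_dependencies (transpose_mat B)}"
proof -
  let ?P = "bernoulli_rows n p"
  define good where "good = (\<lambda>X. only_tree_dependencies (bool_mat n X) \<or> only_tree_dependencies (bool_mat n (\<lambda>i j. X j i)))"
  define s where "s = 2 * small_rate 2048 (real n * p) + real n * (1 / 2) ^ n"
  have n: "0 < n" using d by (cases n) auto
  have "transpose_mat (bool_mat n X) = bool_mat n (\<lambda>i j. X j i)" for X by (rule eq_matI) auto
  then have "measure_pmf.prob (bernoulli_mat n p) {B. only_tree_dependencies B \<or> only_tree_dependencies (transpose_mat B)} = measure_pmf.prob ?P {X. good X}"
    unfolding bernoulli_mat_rows by (simp add: good_def vimage_def)
  also have "\<dots> = 1 - measure_pmf.prob ?P {X. \<not> good X}"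
  proof -
    have "{X. \<not> good X} = space (measure_pmf ?P) - {X. good X}" by auto
    then have "measure_pmf.prob ?P {X. \<not> good X} = 1 - measure_pmf.prob ?P {X. good X}"
      by (simp only:) (rule measure_pmf.prob_compl, simp)
    then show ?thesis by simp
  qed
  finally have eq: "measure_pmf.prob (bernoulli_mat n p) {B. only_tree_dependencies B \<or> only_tree_dependencies (transpose_mat B)} = 1 - measure_pmf.prob ?P {X. \<not> good X}" .
  have "measure_pmf.prob ?P {X. \<not> good X} \<le> measure_pmf.prob ?P {X. short_non_graphic n X \<or> (short_non_graphic n (\<lambda>i j. X j i) \<or> (large_kernel n X \<and> large_kernel n (\<lambda>i j. X j i)))}"
  proof (rule prob_mono)
    fix X assume "\<not> good X"
    then have not: "\<not> only_tree_dependencies (bool_mat n X)" "\<not> only_tree_dependencies (bool_mat n (\<lambda>i j. X j i))"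
      by (auto simp: good_def)
    show "short_non_graphic n X \<or> (short_non_graphic n (\<lambda>i j. X j i) \<or> (large_kernel n X \<and> large_kernel n (\<lambda>i j. X j i)))"
      using not_only_tree_cases[OF not(1)] not_only_tree_cases[OF not(2)] by blast
  qed
  also have "\<dots> \<le> measure_pmf.prob ?P {X. short_non_graphic n X} + (measure_pmf.prob ?P {X. short_non_graphic n (\<lambda>i j. X j i)}
      + measure_pmf.prob ?P {X. large_kernel n X \<and> large_kernel n (\<lambda>i j. X j i)})"
    by (intro order_trans[OF prob_disj_le] add_left_mono prob_disj_le)
  also have "measure_pmf.prob ?P {X. short_non_graphic n (\<lambda>i j. X j i)} = measure_pmf.prob ?P {X. short_non_graphic n X}"
    by (rule prob_rows_transpose)
  also have "measure_pmf.prob ?P {X. short_non_graphic n X} + (measure_pmf.prob ?P {X. short_non_graphic n X}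
      + measure_pmf.prob ?P {X. large_kernel n X \<and> large_kernel n (\<lambda>i j. X j i)}) \<le> s + (s + 2 / sqrt (real n * p))"
    unfolding s_def by (intro add_mono prob_short_non_graphic prob_two_large_kernels p d \<eta> n)
  finally show ?thesis unfolding eq s_def[symmetric] by simp
qed

lemma small_rate_tendsto: "(small_rate K \<longlongrightarrow> 0) at_top"
proof -
  have "((\<lambda>d. 3 * (exp 1 * d)\<^sup>2 * exp (- (d * b / 2))) \<longlongrightarrow> 0) at_top" if "b > 0" for b :: real
    using that by real_asymp
  from this[of "exp (- 2 * K)"] show ?thesis unfolding small_rate_def by simp
qed

theorem theorem1p7:
  fixes p :: "nat \<Rightarrow> real"
  assumes "\<And>n. n \<ge> 1 \<Longrightarrow> 0 \<le> p n \<and> p n \<le> 1 / 2"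
    and "p \<in> \<omega>(\<lambda>n. 1 / real n)"
  shows "(\<lambda>n. measure_pmf.prob (bernoulli_mat n (p n))
            {B. only_tree_dependencies B \<or> only_tree_dependencies (transpose_mat B)})
         \<longlonglongrightarrow> 1"
proof -
  define d where "d = (\<lambda>n. real n * p n)"
  have d: "filterlim d at_top sequentially"
    unfolding filterlim_at_top_gt[of _ _ 0]
  proof (intro allI impI)
    fix Z :: real assume Z: "0 < Z"
    have "eventually (\<lambda>n. Z * norm (1 / real n) \<le> norm (p n)) sequentially"
      using landau_omega.smallD[OF assms(2) Z] .
    then show "eventually (\<lambda>n. Z \<le> d n) sequentially"
      using eventually_ge_at_top[of 1]
    proof eventually_elim
      case (elim n)
      with assms(1)[of n] show ?case by (simp add: d_def field_simps)
    qed
  qed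
  define g where "g = (\<lambda>n. 1 - (2 * (2 * small_rate 2048 (d n) + real n * (1 / 2) ^ n) + 2 / sqrt (d n)))"
  have rate: "(\<lambda>n. small_rate 2048 (d n)) \<longlonglongrightarrow> 0"
    by (rule filterlim_compose[OF small_rate_tendsto d])
  have "((\<lambda>t :: real. 2 / sqrt t) \<longlongrightarrow> 0) at_top" by real_asymp
  then have "(\<lambda>n. 2 / sqrt (d n)) \<longlonglongrightarrow> 0" by (rule filterlim_compose[OF _ d])
  moreover have "(\<lambda>n. real n * (1 / 2) ^ n) \<longlonglongrightarrow> 0" by real_asymp
  ultimately have "g \<longlonglongrightarrow> 1 - (2 * (2 * 0 + 0) + 0)"
    unfolding g_def by (intro tendsto_intros rate)
  then have g: "g \<longlonglongrightarrow> 1" by simp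
  show ?thesis
  proof (rule tendsto_sandwich[OF _ _ g tendsto_const])
    have "eventually (\<lambda>n. small_rate 2048 (d n) < 1 / 2) sequentially"
      using rate by (rule order_tendstoD) simp
    moreover have "eventually (\<lambda>n. 1 \<le> d n) sequentially"
      using d by (simp add: filterlim_at_top)
    ultimately show "eventually (\<lambda>n. g n \<le> measure_pmf.prob (bernoulli_mat n (p n))
            {B. only_tree_dependencies B \<or> only_tree_dependencies (transpose_mat B)}) sequentially"
      using eventually_ge_at_top[of 1]
    proof eventually_elim
      case (elim n)
      have "0 < p n" using elim(2,3) assms(1)[of n] by (cases "p n = 0") (auto simp: d_def)
      then show ?case
        using prob_only_tree_dependencies_ge[of "p n" n] elim assms(1)[of n] by (simp add: g_def d_def)
    qed
  qed simp
qed

end
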